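(* Let $\psi\in C^0(\mathbb{R}^N\times[0,\infty))$ satisfy $\psi\ge0$, $\psi(x,t)\to+\infty$ as $|x|\to\infty$ uniformly for $t\in[0,\infty)$, and $\psi_t\ge J\ast\psi-\psi$. Let $u_0:\mathbb{R}^N\to\mathbb{R}$ be locally bounded and assume that for some $c_0>0$, $|u_0(x)|\le c_0\psi(x,0)$ in $\mathbb{R}^N$. Then there exists a solution $u$ of $u_t=J\ast u-u$ in $\mathbb{R}^N\times(0,\infty)$ with $u(x,0)=u_0(x)$, which is given by $$u(x,t)=e^{-t}u_0(x)+(\omega(t)\ast u_0)(x).$$ Moreover, $|u(x,t)|\le c_0\psi(x,t)$ in $\mathbb{R}^N\times\mathbb{R}_+$.
   Context: $J:\mathbb{R}^N\to\mathbb{R}$ is a nonnegative symmetric continuous function with $\int_{\mathbb{R}^N}J=1$; $\ast$ is convolution in the space variable; $\mathbb{R}_+=(0,\infty)$. $\omega(x,t)=e^{-t}\sum_{n\ge1}\frac{t^n}{n!}J^{\ast n}(x)$, where $J^{\ast n}$ is the convolution of $n$ copies of $J$. "Solution" means strong solution: $u\in C^0([0,\infty);L^1_{\rm loc}(\mathbb{R}^N))$ such that $u_t,J\ast u\in L^1_{\rm loc}(\mathbb{R}^N\times\mathbb{R}_+)$, the equation is satisfied in the $L^1_{\rm loc}$-sense, and $u(x,0)=u_0(x)$ almost everywhere. *)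

theory Defs
  imports "HOL-Analysis.Analysis"
begin

text \<open>
  The space \<open>\<real>\<^sup>N\<close> is an arbitrary type of class \<open>euclidean_space\<close>, and functions of \<open>(x, t)\<close> are
  curried. Their values at \<open>t < 0\<close> are irrelevant throughout.
\<close>

definition convolution_kernel :: "('a::euclidean_space \<Rightarrow> real) \<Rightarrow> bool" where
  "convolution_kernel J \<longleftrightarrow>
     (\<forall>x. J x \<ge> 0) \<and> (\<forall>x. J (- x) = J x) \<and> continuous_on UNIV J \<and>
     has_bochner_integral lebesgue J 1"

text \<open>
  The Bochner integral is \<open>0\<close> for a non-integrable integrand, so \<open>conv f g x\<close> is meaningful only
  where \<open>conv_exists f g x\<close> holds.
\<close>

definition conv_exists :: "('a::euclidean_space \<Rightarrow> real) \<Rightarrow> ('a \<Rightarrow> real) \<Rightarrow> 'a \<Rightarrow> bool" where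
  "conv_exists f g x \<longleftrightarrow> integrable lebesgue (\<lambda>y. f (x - y) * g y)"

definition conv :: "('a::euclidean_space \<Rightarrow> real) \<Rightarrow> ('a \<Rightarrow> real) \<Rightarrow> 'a \<Rightarrow> real" where
  "conv f g x = (LINT y|lebesgue. f (x - y) * g y)"

text \<open>
  Convolution of \<open>n\<close> copies of \<open>J\<close>, for \<open>n \<ge> 1\<close>; the value at \<open>n = 0\<close> is not used. Since \<open>J\<close> may
  be unbounded, these powers and the series below converge only almost everywhere; the values on
  the exceptional null sets do not affect convolutions with \<open>\<omega>(t)\<close>.
\<close>

definition conv_power :: "('a::euclidean_space \<Rightarrow> real) \<Rightarrow> nat \<Rightarrow> 'a \<Rightarrow> real" where
  "conv_power J n = (conv J ^^ (n - 1)) J"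

definition omega :: "('a::euclidean_space \<Rightarrow> real) \<Rightarrow> 'a \<Rightarrow> real \<Rightarrow> real" where
  "omega J x t = exp (- t) * (\<Sum>n. t ^ Suc n / fact (Suc n) * conv_power J (Suc n) x)"

definition locally_bounded :: "('a::euclidean_space \<Rightarrow> real) \<Rightarrow> bool" where
  "locally_bounded f \<longleftrightarrow> (\<forall>K. compact K \<longrightarrow> bounded (f ` K))"

definition L1_loc :: "'b::euclidean_space set \<Rightarrow> ('b \<Rightarrow> real) \<Rightarrow> bool" where
  "L1_loc S f \<longleftrightarrow> (\<forall>K. compact K \<and> K \<subseteq> S \<longrightarrow> f absolutely_integrable_on K)"

definition C0_L1_loc :: "('a::euclidean_space \<Rightarrow> real \<Rightarrow> real) \<Rightarrow> bool" where
  "C0_L1_loc u \<longleftrightarrow>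
     (\<forall>t\<ge>0. L1_loc UNIV (\<lambda>x. u x t)) \<and>
     (\<forall>K. compact K \<longrightarrow>
        (\<forall>t\<ge>0. ((\<lambda>s. LINT x:K|lebesgue. \<bar>u x s - u x t\<bar>) \<longlongrightarrow> 0) (at t within {0..})))"

abbreviation Q_plus :: "('a::euclidean_space \<times> real) set" where
  "Q_plus \<equiv> UNIV \<times> {0<..}"

text \<open>\<open>C_k k f\<close>: all partial derivatives of \<open>f\<close> of order at most \<open>k\<close> exist and are continuous.\<close>

primrec C_k :: "nat \<Rightarrow> ('b::euclidean_space \<Rightarrow> real) \<Rightarrow> bool" where
  "C_k 0 f \<longleftrightarrow> continuous_on UNIV f"
| "C_k (Suc k) f \<longleftrightarrow> continuous_on UNIV f \<and>
     (\<forall>b\<in>Basis. \<exists>g. (\<forall>z. ((\<lambda>s. f (z + s *\<^sub>R b)) has_real_derivative g z) (at 0)) \<and> C_k k g)"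

definition test_function :: "('a::euclidean_space \<times> real \<Rightarrow> real) \<Rightarrow> bool" where
  "test_function \<phi> \<longleftrightarrow>
     (\<forall>k. C_k k \<phi>) \<and> (\<exists>K. compact K \<and> K \<subseteq> Q_plus \<and> (\<forall>z. z \<notin> K \<longrightarrow> \<phi> z = 0))"

definition time_deriv :: "('a \<times> real \<Rightarrow> real) \<Rightarrow> 'a \<times> real \<Rightarrow> real" where
  "time_deriv \<phi> = (\<lambda>(x, t). deriv (\<lambda>s. \<phi> (x, s)) t)"

definition has_weak_time_deriv ::
    "('a::euclidean_space \<Rightarrow> real \<Rightarrow> real) \<Rightarrow> ('a \<times> real \<Rightarrow> real) \<Rightarrow> bool" where
  "has_weak_time_deriv u v \<longleftrightarrow>
     L1_loc Q_plus (\<lambda>(x, t). u x t) \<and> L1_loc Q_plus v \<and>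
     (\<forall>\<phi>. test_function \<phi> \<longrightarrow>
        (LINT (x, t):Q_plus|lebesgue. u x t * time_deriv \<phi> (x, t)) =
        - (LINT z:Q_plus|lebesgue. v z * \<phi> z))"

definition space_conv_L1_loc ::
    "('a::euclidean_space \<Rightarrow> real) \<Rightarrow> ('a \<Rightarrow> real \<Rightarrow> real) \<Rightarrow> bool" where
  "space_conv_L1_loc J u \<longleftrightarrow>
     (AE (x, t) in lebesgue. t > 0 \<longrightarrow> conv_exists J (\<lambda>y. u y t) x) \<and>
     L1_loc Q_plus (\<lambda>(x, t). conv J (\<lambda>y. u y t) x)"

text \<open>Strong solutions of \<open>u\<^sub>t = J * u - u\<close> with initial datum \<open>u\<^sub>0\<close>.\<close>

definition strong_solution ::
    "('a::euclidean_space \<Rightarrow> real) \<Rightarrow> ('a \<Rightarrow> real) \<Rightarrow> ('a \<Rightarrow> real \<Rightarrow> real) \<Rightarrow> bool" where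
  "strong_solution J u0 u \<longleftrightarrow>
     C0_L1_loc u \<and>
     space_conv_L1_loc J u \<and>
     (\<exists>v. has_weak_time_deriv u v \<and>
          (AE (x, t) in lebesgue. t > 0 \<longrightarrow> v (x, t) = conv J (\<lambda>y. u y t) x - u x t)) \<and>
     (AE x in lebesgue. u x 0 = u0 x)"

text \<open>
  The inequality \<open>\<psi>\<^sub>t \<ge> J * \<psi> - \<psi>\<close> for a \<open>\<psi>\<close> that is only continuous: \<open>J * \<psi>\<close> is a locally
  integrable function and the inequality holds in the sense of distributions. In particular this
  is the case if \<open>\<psi>\<^sub>t\<close> is locally integrable and the inequality holds almost everywhere.
\<close>

definition time_deriv_ge ::
    "('a::euclidean_space \<Rightarrow> real) \<Rightarrow> ('a \<Rightarrow> real \<Rightarrow> real) \<Rightarrow> bool" where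
  "time_deriv_ge J \<psi> \<longleftrightarrow>
     space_conv_L1_loc J \<psi> \<and>
     (\<forall>\<phi>. test_function \<phi> \<and> (\<forall>z. \<phi> z \<ge> 0) \<longrightarrow>
        - (LINT (x, t):Q_plus|lebesgue. \<psi> x t * time_deriv \<phi> (x, t)) \<ge>
        (LINT (x, t):Q_plus|lebesgue. (conv J (\<lambda>y. \<psi> y t) x - \<psi> x t) * \<phi> (x, t)))"

end

theory Submission
  imports Defs
begin

text \<open>
  Write \<open>A f = J * f\<close>. Since \<open>A\<close> does not act on time, the equation \<open>u\<^sub>t = A u - u\<close> is at every point
  \<open>x\<close> an ordinary differential equation in \<open>t\<close>, whose formal solution is the exponential series
  \<open>u(x,t) = e\<^sup>-\<^sup>t (\<Sum>n. t\<^sup>n / n! * (A\<^sup>n u\<^sub>0)(x))\<close>. As \<open>A\<^sup>n u\<^sub>0 = J\<^sup>*\<^sup>n * u\<^sub>0\<close> for \<open>n \<ge> 1\<close>, this is the formula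
  of the theorem. The datum may grow at infinity, so the question is why the series converges; the
  answer is that \<open>\<psi>\<close> dominates it.

  The function \<open>e\<^sup>t \<psi>\<close> satisfies \<open>(e\<^sup>t \<psi>)\<^sub>t \<ge> e\<^sup>t A \<psi>\<close>. In integrated form
  \<open>e\<^sup>t \<psi>(x,t) \<ge> \<psi>(x,0) + \<integral>\<^sub>0\<^sup>t A (e\<^sup>\<tau> \<psi>(\<tau>))(x) d\<tau>\<close> (\<open>duhamel_inequality\<close>), and all terms are
  nonnegative, so the inequality can be inserted into its own right-hand side any number of times.
  This gives \<open>(\<Sum>k\<le>n. t\<^sup>k / k! * (A\<^sup>k \<psi>(\<cdot>,0))(x)) \<le> e\<^sup>t \<psi>(x,t)\<close> for every \<open>n\<close> (\<open>picard_bound\<close>).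
  Consequently all \<open>A\<^sup>k \<psi>(\<cdot>,0)\<close> are finite everywhere, and with \<open>\<bar>u\<^sub>0\<bar> \<le> c\<^sub>0 \<psi>(\<cdot>,0)\<close> the series
  for \<open>u\<close> converges absolutely, with \<open>\<bar>u\<bar> \<le> c\<^sub>0 \<psi>\<close>.

  The differential inequality holds only in the sense of distributions, whereas the integrated one is
  needed at every point. For this, \<open>A \<psi>\<close> is first replaced by the integral of \<open>J (x - y) * \<psi> y t\<close>
  over a box, which is smaller and continuous in \<open>(x,t)\<close>. Moving it to the left-hand side gives a
  continuous function whose distributional time derivative is nonnegative, and such a function is
  nondecreasing in \<open>t\<close> at every \<open>x\<close>: otherwise a product of a bump in space and a bump-shaped step
  in time would be a test function that detects the decrease
  (\<open>nondecreasing_of_weak_derivative_nonneg\<close>). Monotone convergence along growing boxes gives \<open>A \<psi>\<close>.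

  The time derivative of the series is the same series with \<open>A\<^sup>n\<^sup>+\<^sup>1 u\<^sub>0 - A\<^sup>n u\<^sub>0\<close> in place of
  \<open>A\<^sup>n u\<^sub>0\<close>, hence equal to \<open>A u - u\<close>. The shifted series is locally bounded because
  \<open>(n + 1) t\<^sup>n \<le> (t + 1)\<^sup>n\<^sup>+\<^sup>1\<close> bounds it by the original one at time \<open>t + 1\<close>. Local boundedness and
  pointwise differentiability in \<open>t\<close> yield the remaining properties of a strong solution by
  dominated convergence and by integration by parts in \<open>t\<close> on each line \<open>{x} \<times> (0,\<infinity>)\<close>.
\<close>

section \<open>Smooth functions and bumps\<close>

lemma C_k_continuous: "C_k k f \<Longrightarrow> continuous_on UNIV f"
  by (cases k) auto

lemma C_k_SucD: "C_k (Suc k) f \<Longrightarrow> C_k k f"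
proof (induction k arbitrary: f)
  case (Suc k)
  then show ?case by (metis C_k.simps(2))
qed (simp add: C_k_continuous)

lemma C_k_Suc_derivative:
  assumes "C_k (Suc k) f" and "b \<in> Basis"
  obtains f' where "\<And>z. ((\<lambda>s. f (z + s *\<^sub>R b)) has_real_derivative f' z) (at 0)" "C_k k f'"
  using assms by auto

lemma C_k_const: "C_k k (\<lambda>z::'a::euclidean_space. c)"
proof (induction k arbitrary: c)
  case (Suc k)
  then have "\<exists>g. (\<forall>z::'a. ((\<lambda>s. c) has_real_derivative g z) (at 0)) \<and> C_k k g"
    by (intro exI[of _ "\<lambda>z. 0"]) auto
  then show ?case by auto
qed simp

lemma C_k_add:
  fixes f g :: "'a::euclidean_space \<Rightarrow> real"
  shows "C_k k f \<Longrightarrow> C_k k g \<Longrightarrow> C_k k (\<lambda>z. f z + g z)"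
proof (induction k arbitrary: f g)
  case (Suc k)
  show ?case unfolding C_k.simps
  proof (intro conjI ballI)
    show "continuous_on UNIV (\<lambda>z. f z + g z)"
      using Suc.prems by (intro continuous_intros) (auto simp: C_k_continuous)
    fix b :: 'a assume b: "b \<in> Basis"
    from C_k_Suc_derivative[OF Suc.prems(1) b] obtain f' where
      f: "\<And>z. ((\<lambda>s. f (z + s *\<^sub>R b)) has_real_derivative f' z) (at 0)" "C_k k f'" by blast
    from C_k_Suc_derivative[OF Suc.prems(2) b] obtain g' where
      g: "\<And>z. ((\<lambda>s. g (z + s *\<^sub>R b)) has_real_derivative g' z) (at 0)" "C_k k g'" by blast
    have "((\<lambda>s. f (z + s *\<^sub>R b) + g (z + s *\<^sub>R b)) has_real_derivative (f' z + g' z)) (at 0)" for z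
      by (rule DERIV_add[OF f(1) g(1)])
    then show "\<exists>h. (\<forall>z. ((\<lambda>s. f (z + s *\<^sub>R b) + g (z + s *\<^sub>R b)) has_real_derivative h z) (at 0)) \<and> C_k k h"
      by (intro exI[of _ "\<lambda>z. f' z + g' z"] conjI allI Suc.IH f g) auto
  qed
qed (auto intro: continuous_intros)

lemma C_k_mult:
  fixes f g :: "'a::euclidean_space \<Rightarrow> real"
  shows "C_k k f \<Longrightarrow> C_k k g \<Longrightarrow> C_k k (\<lambda>z. f z * g z)"
proof (induction k arbitrary: f g)
  case (Suc k)
  show ?case unfolding C_k.simps
  proof (intro conjI ballI)
    show "continuous_on UNIV (\<lambda>z. f z * g z)"
      using Suc.prems by (intro continuous_intros) (auto simp: C_k_continuous)
    fix b :: 'a assume b: "b \<in> Basis"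
    from C_k_Suc_derivative[OF Suc.prems(1) b] obtain f' where
      f: "\<And>z. ((\<lambda>s. f (z + s *\<^sub>R b)) has_real_derivative f' z) (at 0)" "C_k k f'" by blast
    from C_k_Suc_derivative[OF Suc.prems(2) b] obtain g' where
      g: "\<And>z. ((\<lambda>s. g (z + s *\<^sub>R b)) has_real_derivative g' z) (at 0)" "C_k k g'" by blast
    have "((\<lambda>s. f (z + s *\<^sub>R b) * g (z + s *\<^sub>R b)) has_real_derivative (f' z * g z + g' z * f z)) (at 0)" for z
      using DERIV_mult[OF f(1) g(1), of z z] by simp
    moreover have "C_k k (\<lambda>z. f' z * g z + g' z * f z)"
      by (intro C_k_add Suc.IH f g C_k_SucD[OF Suc.prems(1)] C_k_SucD[OF Suc.prems(2)])
    ultimately show "\<exists>h. (\<forall>z. ((\<lambda>s. f (z + s *\<^sub>R b) * g (z + s *\<^sub>R b)) has_real_derivative h z) (at 0)) \<and> C_k k h"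
      by (intro exI[of _ "\<lambda>z. f' z * g z + g' z * f z"]) auto
  qed
qed (auto intro: continuous_intros)

lemma C_k_sum: "(\<And>i. i \<in> I \<Longrightarrow> C_k k (f i)) \<Longrightarrow> C_k k (\<lambda>z. \<Sum>i\<in>I. f i z)"
  by (induction I rule: infinite_finite_induct) (auto intro: C_k_add C_k_const)

lemma C_k_inner: "C_k k (\<lambda>z. z \<bullet> a)"
proof (cases k)
  case (Suc m)
  have "\<exists>g. (\<forall>z. ((\<lambda>s. (z + s *\<^sub>R b) \<bullet> a) has_real_derivative g z) (at 0)) \<and> C_k m g" for b
    by (rule exI[of _ "\<lambda>z. b \<bullet> a"])
       (auto intro!: derivative_eq_intros C_k_const simp: inner_add_left)
  then show ?thesis by (auto simp: Suc intro: continuous_intros)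
qed (auto intro: continuous_intros)

text \<open>
  On the real line the only partial derivative is the ordinary one, so \<open>C_k\<close> takes the usual recursive
  form. It makes derivatives and antiderivatives of smooth functions smooth.
\<close>

lemma C_k_Suc_real:
  fixes f :: "real \<Rightarrow> real"
  shows "C_k (Suc k) f \<longleftrightarrow> (\<exists>g. (\<forall>z. (f has_real_derivative g z) (at z)) \<and> C_k k g)"
proof -
  have *: "((\<lambda>s. f (z + s)) has_real_derivative d) (at 0) \<longleftrightarrow> (f has_real_derivative d) (at z)" for z d
    using DERIV_shift[of f d 0 z] by (simp add: add.commute)
  show ?thesis
    by (auto simp: * intro!: continuous_at_imp_continuous_on DERIV_isCont)
qed

lemma smooth_derivative:
  fixes f :: "real \<Rightarrow> real"
  assumes "\<forall>k. C_k k f" and "\<And>t. (f has_real_derivative g t) (at t)"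
  shows "\<forall>k. C_k k g"
proof
  fix k
  from assms(1) have "C_k (Suc k) f" by blast
  then obtain h where h: "\<And>z. (f has_real_derivative h z) (at z)" "C_k k h"
    unfolding C_k_Suc_real by blast
  have "h = g" using DERIV_unique[OF h(1) assms(2)] by auto
  with h show "C_k k g" by simp
qed

lemma smooth_antiderivative:
  fixes f :: "real \<Rightarrow> real"
  assumes "\<forall>k. C_k k g" and "\<And>t. (f has_real_derivative g t) (at t)"
  shows "\<forall>k. C_k k f"
proof
  fix k
  have "C_k (Suc k) f" unfolding C_k_Suc_real using assms by (intro exI[of _ g]) auto
  then show "C_k k f" by (rule C_k_SucD)
qed

lemma smooth_compose:
  fixes h :: "real \<Rightarrow> real" and q :: "'a::euclidean_space \<Rightarrow> real"
  assumes h: "\<forall>k. C_k k h" and q: "\<forall>k. C_k k q"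
  shows "\<forall>k. C_k k (\<lambda>z. h (q z))"
proof
  fix k
  from h show "C_k k (\<lambda>z. h (q z))"
  proof (induction k arbitrary: h)
    case 0
    have "continuous_on UNIV h" "continuous_on UNIV q"
      using 0 q C_k_continuous by blast+
    then show ?case by (auto intro: continuous_on_compose2)
  next
    case (Suc k)
    show ?case unfolding C_k.simps
    proof (intro conjI ballI)
      have "continuous_on UNIV h" "continuous_on UNIV q"
        using Suc.prems q C_k_continuous by blast+
      then show "continuous_on UNIV (\<lambda>z. h (q z))" by (auto intro: continuous_on_compose2)
      fix b :: 'a assume b: "b \<in> Basis"
      from q have "C_k (Suc k) q" by blast
      with b obtain q' where
        q': "\<And>z. ((\<lambda>s. q (z + s *\<^sub>R b)) has_real_derivative q' z) (at 0)" "C_k k q'"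
        by auto
      from Suc.prems have "C_k (Suc k) h" by blast
      then obtain h' where h': "\<And>z. (h has_real_derivative h' z) (at z)"
        unfolding C_k_Suc_real by blast
      have "\<forall>k. C_k k h'" by (rule smooth_derivative[OF Suc.prems h'])
      then have "C_k k (\<lambda>z. h' (q z) * q' z)"
        by (intro C_k_mult q' Suc.IH)
      moreover have "((\<lambda>s. h (q (z + s *\<^sub>R b))) has_real_derivative h' (q z) * q' z) (at 0)" for z
        using DERIV_chain2[of h "h' (q z)" "\<lambda>s. q (z + s *\<^sub>R b)" 0, OF _ q'(1)[of z]] h' by simp
      ultimately show "\<exists>g. (\<forall>z. ((\<lambda>s. h (q (z + s *\<^sub>R b))) has_real_derivative g z) (at 0)) \<and> C_k k g"
        by (intro exI[of _ "\<lambda>z. h' (q z) * q' z"]) auto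
    qed
  qed
qed

text \<open>
  The function \<open>flat 0\<close> is the standard smooth function \<open>e\<^sup>-\<^sup>1\<^sup>/\<^sup>t\<close> that vanishes to infinite order at
  \<open>0\<close>. The powers of \<open>1/t\<close> are included because the derivative of \<open>flat n\<close> is a linear combination of
  \<open>flat (n + 1)\<close> and \<open>flat (n + 2)\<close>, so that smoothness of the whole family follows by one induction.
\<close>

definition flat :: "nat \<Rightarrow> real \<Rightarrow> real" where
  "flat n t = (if t > 0 then inverse t ^ n * exp (- inverse t) else 0)"

lemma flat_tendsto: "((\<lambda>t. flat n t) \<longlongrightarrow> 0) (at 0)"
proof -
  have r: "(flat n \<longlongrightarrow> 0) (at_right 0)"
  proof (rule Lim_transform_eventually)
    have "((\<lambda>x::real. x ^ n / exp x) \<longlongrightarrow> 0) at_top" by (rule tendsto_power_div_exp_0)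
    from filterlim_compose[OF this filterlim_inverse_at_top_right]
    show "((\<lambda>t::real. inverse t ^ n / exp (inverse t)) \<longlongrightarrow> 0) (at_right 0)" .
    show "\<forall>\<^sub>F t in at_right 0. inverse t ^ n / exp (inverse t) = flat n t"
      by (auto simp: eventually_at_filter flat_def exp_minus divide_inverse)
  qed
  have "(flat n \<longlongrightarrow> 0) (at_left 0)"
    by (rule Lim_transform_eventually[OF tendsto_const])
       (auto simp: eventually_at_filter flat_def)
  with r show ?thesis by (simp add: filterlim_at_split)
qed

lemma flat_derivative:
  "(flat n has_real_derivative flat (n + 2) t - n * flat (Suc n) t) (at t)"
proof -
  consider "t > 0" | "t < 0" | "t = 0" by linarith
  then show ?thesis
  proof cases
    case 1
    have "((\<lambda>t. inverse t ^ n * exp (- inverse t)) has_real_derivative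
        flat (n + 2) t - n * flat (Suc n) t) (at t)"
    proof (cases n)
      case 0
      then show ?thesis using 1
        by (auto intro!: derivative_eq_intros simp: flat_def power2_eq_square)
    next
      case (Suc m)
      have "((\<lambda>t. inverse t ^ Suc m) has_real_derivative - (Suc m * inverse t ^ Suc (Suc m))) (at t)"
        using 1 by (intro DERIV_power[OF DERIV_inverse, THEN DERIV_cong])
          (simp_all add: power2_eq_square algebra_simps)
      note power = this
      have "((\<lambda>t. exp (- inverse t)) has_real_derivative (inverse t)\<^sup>2 * exp (- inverse t)) (at t)"
        using 1 by (auto intro!: derivative_eq_intros simp: power2_eq_square)
      from DERIV_mult[OF power this] show ?thesis unfolding Suc
        by (rule DERIV_cong) (use 1 in \<open>simp add: flat_def power2_eq_square algebra_simps\<close>)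
    qed
    then show ?thesis
      by (rule has_field_derivative_transform_within_open[of _ _ _ "{0<..}"])
         (use 1 in \<open>auto simp: flat_def\<close>)
  next
    case 2
    have "((\<lambda>t. 0) has_real_derivative flat (n + 2) t - n * flat (Suc n) t) (at t)"
      using 2 by (auto simp: flat_def)
    then show ?thesis
      by (rule has_field_derivative_transform_within_open[of _ _ _ "{..<0}"])
         (use 2 in \<open>auto simp: flat_def\<close>)
  next
    case 3
    have "(\<lambda>h. (flat n (0 + h) - flat n 0) / h) = flat (Suc n)"
      by (auto simp: flat_def divide_inverse)
    with flat_tendsto[of "Suc n"] have "(flat n has_real_derivative 0) (at 0)"
      unfolding DERIV_def by simp
    then show ?thesis by (simp add: 3 flat_def[of _ 0])
  qed
qed

lemma flat_smooth: "\<forall>k. C_k k (flat n)"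
proof
  fix k show "C_k k (flat n)"
  proof (induction k arbitrary: n)
    case 0
    show ?case
      by (auto intro!: continuous_at_imp_continuous_on DERIV_isCont flat_derivative)
  next
    case (Suc k)
    have "C_k k (\<lambda>t. flat (n + 2) t + (- n) * flat (Suc n) t)"
      by (intro C_k_add C_k_mult C_k_const Suc)
    then show ?case unfolding C_k_Suc_real
      using flat_derivative[of n] by (intro exI[of _ "\<lambda>t. flat (n + 2) t - n * flat (Suc n) t"]) auto
  qed
qed

lemma flat_nonneg: "flat n t \<ge> 0"
  by (simp add: flat_def)

text \<open>
  The squared norm is used because it is a polynomial in the coordinates, hence smooth also at the
  centre of the ball.
\<close>

definition ball_bump :: "'a::real_normed_vector \<Rightarrow> real \<Rightarrow> 'a \<Rightarrow> real" where
  "ball_bump a \<delta> x = flat 0 (\<delta>\<^sup>2 - (norm (x - a))\<^sup>2)"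

lemma ball_bump_nonneg: "ball_bump a \<delta> x \<ge> 0"
  by (simp add: ball_bump_def flat_nonneg)

lemma ball_bump_pos_iff:
  assumes "\<delta> > 0"
  shows "ball_bump a \<delta> x > 0 \<longleftrightarrow> norm (x - a) < \<delta>"
proof -
  have "(norm (x - a))\<^sup>2 < \<delta>\<^sup>2 \<longleftrightarrow> norm (x - a) < \<delta>"
    using assms power_mono_iff[of \<delta> "norm (x - a)" 2] by (simp flip: linorder_not_le)
  then show ?thesis by (simp add: ball_bump_def flat_def)
qed

lemma ball_bump_eq_0:
  assumes "\<delta> > 0" and "norm (x - a) \<ge> \<delta>"
  shows "ball_bump a \<delta> x = 0"
  using assms ball_bump_pos_iff[of \<delta> a x] ball_bump_nonneg[of a \<delta> x] by linarith

text \<open>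
  The map \<open>L\<close> with linear coordinates is there for \<open>L = fst\<close>: a bump in \<open>x\<close> is a smooth function of
  \<open>(x,t)\<close>.
\<close>

lemma ball_bump_smooth:
  fixes L :: "'b::euclidean_space \<Rightarrow> 'a::euclidean_space"
  assumes "\<And>b. b \<in> Basis \<Longrightarrow> \<exists>c. \<forall>z. L z \<bullet> b = z \<bullet> c"
  shows "C_k k (\<lambda>z. ball_bump a \<delta> (L z))"
proof -
  have "\<forall>k. C_k k (\<lambda>z. \<delta>\<^sup>2 + (- 1) * (\<Sum>b\<in>Basis. (L z \<bullet> b + (- (a \<bullet> b))) * (L z \<bullet> b + (- (a \<bullet> b)))))"
  proof
    fix k
    have *: "C_k k (\<lambda>z. L z \<bullet> b)" if "b \<in> Basis" for b
    proof -
      from assms[OF that] obtain c where "\<And>z. L z \<bullet> b = z \<bullet> c" by blast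
      then show ?thesis by (simp add: C_k_inner)
    qed
    show "C_k k (\<lambda>z. \<delta>\<^sup>2 + (- 1) * (\<Sum>b\<in>Basis. (L z \<bullet> b + (- (a \<bullet> b))) * (L z \<bullet> b + (- (a \<bullet> b)))))"
      by (intro C_k_add C_k_mult C_k_sum C_k_const *)
  qed
  from smooth_compose[OF flat_smooth this, of 0]
  have "\<forall>k. C_k k (\<lambda>z. flat 0 (\<delta>\<^sup>2 - (\<Sum>b\<in>Basis. ((L z - a) \<bullet> b) * ((L z - a) \<bullet> b))))"
    by (simp add: inner_diff_left)
  then show ?thesis
    by (simp add: ball_bump_def power2_norm_eq_inner flip: euclidean_inner)
qed

lemma test_function_product:
  fixes a :: "'a::euclidean_space"
  assumes "\<delta> > 0" and \<eta>: "\<forall>k. C_k k \<eta>" and "l > 0" and zero: "\<And>t. t \<notin> {l..r} \<Longrightarrow> \<eta> t = 0"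
  shows "test_function (\<lambda>(x, t). ball_bump a \<delta> x * \<eta> t)"
  unfolding test_function_def
proof (intro conjI allI impI exI[of _ "cball a \<delta> \<times> {l..r}"])
  fix k
  have "\<forall>z::'a \<times> real. fst z \<bullet> b = z \<bullet> (b, 0)" for b
    by (simp add: inner_prod_def)
  then have "C_k k (\<lambda>z::'a \<times> real. ball_bump a \<delta> (fst z))"
    by (intro ball_bump_smooth) blast
  moreover have "\<forall>k. C_k k (\<lambda>z::'a \<times> real. z \<bullet> (0, 1))"
    by (simp add: C_k_inner)
  from smooth_compose[OF \<eta> this] have "C_k k (\<lambda>z::'a \<times> real. \<eta> (snd z))"
    by (simp add: inner_prod_def)
  ultimately show "C_k k (\<lambda>(x, t). ball_bump a \<delta> x * \<eta> t)"
    unfolding case_prod_beta by (rule C_k_mult)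
next
  show "compact (cball a \<delta> \<times> {l..r})"
    by (intro compact_Times compact_cball compact_Icc)
  show "cball a \<delta> \<times> {l..r} \<subseteq> Q_plus" using \<open>l > 0\<close> by auto
next
  fix z assume "z \<notin> cball a \<delta> \<times> {l..r}"
  then show "(case z of (x, t) \<Rightarrow> ball_bump a \<delta> x * \<eta> t) = 0"
    using ball_bump_eq_0[OF \<open>\<delta> > 0\<close>, of "fst z" a] zero[of "snd z"]
    by (cases z) (auto simp: dist_norm norm_minus_commute)
qed

section \<open>Test functions and integration by parts in time\<close>

lemma test_function_time_derivative:
  fixes \<phi> :: "'a::euclidean_space \<times> real \<Rightarrow> real"
  assumes "test_function \<phi>"
  shows "((\<lambda>s. \<phi> (x, s)) has_real_derivative time_deriv \<phi> (x, t)) (at t)"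
    and "continuous_on UNIV (time_deriv \<phi>)"
proof -
  have "C_k (Suc 0) \<phi>" using assms unfolding test_function_def by blast
  moreover have "(0, 1) \<in> (Basis :: ('a \<times> real) set)" by (simp add: Basis_prod_def)
  ultimately obtain g where
    g: "\<And>z. ((\<lambda>s. \<phi> (z + s *\<^sub>R (0, 1))) has_real_derivative g z) (at 0)" "C_k 0 g"
    by (rule C_k_Suc_derivative) blast
  have *: "((\<lambda>s. \<phi> (x, s)) has_real_derivative g (x, t)) (at t)" for x t
    using g(1)[of "(x, t)"] DERIV_shift[of "\<lambda>s. \<phi> (x, s)" "g (x, t)" 0 t]
    by (simp add: add.commute)
  then have "time_deriv \<phi> = g"
    by (auto simp: time_deriv_def fun_eq_iff intro: DERIV_imp_deriv)
  with * g(2) show "((\<lambda>s. \<phi> (x, s)) has_real_derivative time_deriv \<phi> (x, t)) (at t)"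
    and "continuous_on UNIV (time_deriv \<phi>)" by simp_all
qed

lemma test_function_support:
  fixes \<phi> :: "'a::euclidean_space \<times> real \<Rightarrow> real"
  assumes "test_function \<phi>"
  obtains R l r where "0 < l" "l \<le> r"
    "\<And>x t. (x, t) \<notin> cball 0 R \<times> {l..r} \<Longrightarrow> \<phi> (x, t) = 0"
    "\<And>x t. (x, t) \<notin> cball 0 R \<times> {l..r} \<Longrightarrow> time_deriv \<phi> (x, t) = 0"
proof -
  obtain K where K: "compact K" "K \<subseteq> Q_plus" "\<And>z. z \<notin> K \<Longrightarrow> \<phi> z = 0"
    using assms unfolding test_function_def by blast
  have d0: "time_deriv \<phi> (x, t) = 0" if "(x, t) \<notin> K" for x t
  proof -
    have "open (- K)" using K(1) by (simp add: compact_imp_closed open_Compl)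
    then have "open ((\<lambda>s. (x, s)) -` (- K))"
      by (rule open_vimage) (intro continuous_intros)
    moreover have "t \<in> (\<lambda>s. (x, s)) -` (- K)" using that by simp
    ultimately have "((\<lambda>s. \<phi> (x, s)) has_real_derivative 0) (at t)"
      by (rule has_field_derivative_transform_within_open[OF DERIV_const[of 0]]) (use K(3) in auto)
    then show ?thesis using test_function_time_derivative(1)[OF assms] DERIV_unique by blast
  qed
  show ?thesis
  proof (cases "K = {}")
    case True
    then show ?thesis using that[of 1 1 0] K(3) d0 by auto
  next
    case False
    have c: "compact (snd ` K)" using K(1) by (intro compact_continuous_image continuous_intros)
    with False obtain l where l: "l \<in> snd ` K" "\<And>t. t \<in> snd ` K \<Longrightarrow> l \<le> t"
      using compact_attains_inf[of "snd ` K"] by auto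
    from c False obtain r where r: "r \<in> snd ` K" "\<And>t. t \<in> snd ` K \<Longrightarrow> t \<le> r"
      using compact_attains_sup[of "snd ` K"] by auto
    have "bounded (fst ` K)" using K(1)
      by (intro compact_imp_bounded compact_continuous_image continuous_intros)
    then obtain R where R: "\<And>x. x \<in> fst ` K \<Longrightarrow> norm x \<le> R"
      by (auto simp: bounded_iff)
    have "K \<subseteq> cball 0 R \<times> {l..r}"
      using l r R by (force simp: image_iff)
    moreover have "0 < l" using l(1) K(2) by auto
    ultimately show ?thesis using that[of l r R] l r K(3) d0 by blast
  qed
qed

lemma integrable_compact_support:
  fixes h :: "'b::euclidean_space \<Rightarrow> real"
  assumes "h \<in> borel_measurable borel" and "compact K"
    and "\<And>z. z \<in> K \<Longrightarrow> \<bar>h z\<bar> \<le> C" and "\<And>z. z \<notin> K \<Longrightarrow> h z = 0"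
  shows "integrable lborel h"
proof -
  have "integrable lborel (\<lambda>z. indicator K z *\<^sub>R h z)"
    using assms by (intro integrableI_bounded_set_indicator[where B = C])
      (auto intro: borel_compact simp: emeasure_bounded_finite compact_imp_bounded simp flip: infinity_ennreal_def)
  moreover have "(\<lambda>z. indicator K z *\<^sub>R h z) = h"
    using assms(4) by (auto simp: indicator_def fun_eq_iff)
  ultimately show ?thesis by simp
qed

lemma integral_lebesgue_borel:
  fixes h :: "'b::euclidean_space \<Rightarrow> real"
  assumes "h \<in> borel_measurable borel"
  shows "integral\<^sup>L lebesgue h = integral\<^sup>L lborel h"
  using assms by (intro integral_completion) simp

lemma test_function_bounded:
  fixes \<phi> :: "'a::euclidean_space \<times> real \<Rightarrow> real"
  assumes "test_function \<phi>"
  obtains C where "\<And>z. \<bar>\<phi> z\<bar> \<le> C" "\<And>z. \<bar>time_deriv \<phi> z\<bar> \<le> C"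
proof -
  obtain R l r where R: "0 < l" "l \<le> r"
    "\<And>x t. (x, t) \<notin> cball 0 R \<times> {l..r} \<Longrightarrow> \<phi> (x, t) = 0"
    "\<And>x t. (x, t) \<notin> cball 0 R \<times> {l..r} \<Longrightarrow> time_deriv \<phi> (x, t) = 0"
    by (rule test_function_support[OF assms]) blast
  let ?K = "cball 0 R \<times> {l..r} :: ('a \<times> real) set"
  have K: "compact ?K" by (intro compact_Times compact_cball compact_Icc)
  have c: "continuous_on UNIV \<phi>" using assms unfolding test_function_def
    using C_k_continuous by blast
  have "bounded (\<phi> ` ?K)" "bounded (time_deriv \<phi> ` ?K)"
    using K c test_function_time_derivative(2)[OF assms]
    by (auto intro!: compact_imp_bounded compact_continuous_image continuous_on_subset[of UNIV])
  then obtain A B where A: "\<And>z. z \<in> ?K \<Longrightarrow> \<bar>\<phi> z\<bar> \<le> A" and B: "\<And>z. z \<in> ?K \<Longrightarrow> \<bar>time_deriv \<phi> z\<bar> \<le> B"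
    unfolding bounded_iff by (metis image_eqI real_norm_def)
  have "\<bar>\<phi> z\<bar> \<le> max 0 (max A B)" "\<bar>time_deriv \<phi> z\<bar> \<le> max 0 (max A B)" for z
    using R(3,4)[of "fst z" "snd z"] A[of z] B[of z] by (cases "z \<in> ?K"; simp)+
  then show ?thesis by (intro that[of "max 0 (max A B)"]) auto
qed

lemma set_integral_Q_plus_test:
  fixes \<phi> :: "'a::euclidean_space \<times> real \<Rightarrow> real"
  assumes "\<And>z. z \<notin> Q_plus \<Longrightarrow> g z = 0"
  shows "(LINT z:Q_plus|lebesgue. f z * g z) = (LINT z|lebesgue. f z * g z :: real)"
  unfolding set_lebesgue_integral_def
  using assms by (intro Bochner_Integration.integral_cong) (auto simp: indicator_def)

lemma set_integral_Q_plus_lborel: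
  fixes u :: "'a::euclidean_space \<Rightarrow> real \<Rightarrow> real"
  assumes [measurable]: "(\<lambda>z. u (fst z) (snd z)) \<in> borel_measurable borel" "g \<in> borel_measurable borel"
    and "\<And>z. z \<notin> Q_plus \<Longrightarrow> g z = 0"
  shows "(LINT (x, t):Q_plus|lebesgue. u x t * g (x, t)) = (\<integral>z. u (fst z) (snd z) * g z \<partial>lborel)"
  using set_integral_Q_plus_test[of g "\<lambda>z. u (fst z) (snd z)"] assms(3)
  by (subst integral_lebesgue_borel[symmetric]) (auto simp: case_prod_unfold)

lemma integrable_continuous_compact_support:
  fixes h :: "'b::euclidean_space \<Rightarrow> real"
  assumes "continuous_on UNIV h" and "compact K" and "\<And>z. z \<notin> K \<Longrightarrow> h z = 0"
  shows "integrable lborel h"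
proof -
  have "bounded (h ` K)"
    by (intro compact_imp_bounded compact_continuous_image assms continuous_on_subset[OF assms(1)]) simp
  then obtain C where "\<And>z. z \<in> K \<Longrightarrow> \<bar>h z\<bar> \<le> C"
    unfolding bounded_iff by (metis image_eqI real_norm_def)
  then show ?thesis
    using assms by (intro integrable_compact_support[of h K C] borel_measurable_continuous_onI) auto
qed

text \<open>
  By Fubini it is enough to integrate over one line \<open>{x} \<times> (0,\<infinity>)\<close>, where \<open>(u \<phi>)\<^sub>t = v \<phi> + u \<phi>\<^sub>t\<close>
  integrates to \<open>0\<close> since \<open>\<phi>\<close> vanishes for small and for large times. Boundedness on compact sets
  makes the double integral converge.
\<close>

lemma integration_by_parts_test_function:
  fixes u v :: "'a::euclidean_space \<Rightarrow> real \<Rightarrow> real"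
  assumes \<phi>: "test_function \<phi>"
    and [measurable]: "(\<lambda>z. u (fst z) (snd z)) \<in> borel_measurable borel"
      "(\<lambda>z. v (fst z) (snd z)) \<in> borel_measurable borel"
    and deriv: "\<And>x t. t > 0 \<Longrightarrow> (u x has_real_derivative v x t) (at t)"
    and cont: "\<And>x t. t > 0 \<Longrightarrow> isCont (v x) t"
    and bdd: "\<And>R l r. 0 < l \<Longrightarrow> \<exists>C. \<forall>x\<in>cball 0 R. \<forall>t\<in>{l..r}. \<bar>u x t\<bar> \<le> C \<and> \<bar>v x t\<bar> \<le> C"
  shows "(LINT (x, t):Q_plus|lebesgue. u x t * time_deriv \<phi> (x, t)) =
    - (LINT (x, t):Q_plus|lebesgue. v x t * \<phi> (x, t))"
proof -
  obtain R l r where R: "0 < l" "l \<le> r"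
    "\<And>x t. (x, t) \<notin> cball 0 R \<times> {l..r} \<Longrightarrow> \<phi> (x, t) = 0"
    "\<And>x t. (x, t) \<notin> cball 0 R \<times> {l..r} \<Longrightarrow> time_deriv \<phi> (x, t) = 0"
    by (rule test_function_support[OF \<phi>]) blast
  let ?K = "cball 0 R \<times> {l..r} :: ('a \<times> real) set"
  have K: "compact ?K" by (intro compact_Times compact_cball compact_Icc)
  have c\<phi>: "continuous_on UNIV \<phi>" using \<phi> unfolding test_function_def
    using C_k_continuous by blast
  note c\<phi>' = test_function_time_derivative(2)[OF \<phi>]
  have [measurable]: "\<phi> \<in> borel_measurable borel" "time_deriv \<phi> \<in> borel_measurable borel"
    using c\<phi> c\<phi>' by (auto intro: borel_measurable_continuous_onI)
  obtain D where D: "\<And>z. \<bar>\<phi> z\<bar> \<le> D" "\<And>z. \<bar>time_deriv \<phi> z\<bar> \<le> D"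
    by (rule test_function_bounded[OF \<phi>]) blast
  from bdd[OF \<open>0 < l\<close>, of R r] obtain C
    where C: "\<And>x t. (x, t) \<in> ?K \<Longrightarrow> \<bar>u x t\<bar> \<le> C" "\<And>x t. (x, t) \<in> ?K \<Longrightarrow> \<bar>v x t\<bar> \<le> C"
    by (metis mem_Sigma_iff)
  have R': "z \<notin> ?K \<Longrightarrow> \<phi> z = 0" "z \<notin> ?K \<Longrightarrow> time_deriv \<phi> z = 0" for z
    using R(3,4)[of "fst z" "snd z"] by simp_all
  have "\<bar>u (fst z) (snd z) * time_deriv \<phi> z\<bar> \<le> C * D" "\<bar>v (fst z) (snd z) * \<phi> z\<bar> \<le> C * D"
    if "z \<in> ?K" for z
    using C[of "fst z" "snd z"] D[of z] that unfolding abs_mult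
    by (auto intro!: mult_mono order_trans[OF abs_ge_zero])
  note bound = this
  let ?f = "\<lambda>z. u (fst z) (snd z) * time_deriv \<phi> z" and ?g = "\<lambda>z. v (fst z) (snd z) * \<phi> z"
  have f: "integrable lborel ?f"
    by (rule integrable_compact_support[OF _ K bound(1)]) (use R' in auto)
  have g: "integrable lborel ?g"
    by (rule integrable_compact_support[OF _ K bound(2)]) (use R' in auto)
  let ?h = "\<lambda>z. ?f z + ?g z"
  have h: "integrable (lborel \<Otimes>\<^sub>M lborel) ?h"
    unfolding lborel_prod using f g by (rule Bochner_Integration.integrable_add)
  have inner: "(\<integral>t. ?h (x, t) \<partial>lborel) = 0" for x
  proof -
    have d: "((\<lambda>s. u x s * \<phi> (x, s)) has_real_derivative ?h (x, t)) (at t)" if "t > 0" for t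
      using DERIV_mult[OF deriv[OF that] test_function_time_derivative(1)[OF \<phi>], of x x]
      by (simp add: algebra_simps)
    have cc: "isCont (\<lambda>t. ?h (x, t)) t" if "t > 0" for t
    proof -
      have "isCont (\<lambda>t. \<phi> (x, t)) t" "isCont (\<lambda>t. time_deriv \<phi> (x, t)) t"
        using continuous_on_compose2[OF c\<phi>, of UNIV "\<lambda>t. (x, t)"]
          continuous_on_compose2[OF c\<phi>', of UNIV "\<lambda>t. (x, t)"]
        by (auto simp: continuous_on_eq_continuous_at intro!: continuous_intros)
      then show ?thesis using cont[OF that] DERIV_isCont[OF deriv[OF that]]
        by (auto intro!: continuous_intros)
    qed
    \<comment> \<open>The interval is larger than \<open>{l..r}\<close>, so that \<open>\<phi>\<close> is zero at both of its end points.\<close>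
    have "(\<integral>t. ?h (x, t) * indicator {l / 2..r + 1} t \<partial>lborel) =
        u x (r + 1) * \<phi> (x, r + 1) - u x (l / 2) * \<phi> (x, l / 2)"
      using R(1,2) by (intro integral_FTC_Icc_real d cc) auto
    also have "\<dots> = 0" using R by auto
    also have "(\<lambda>t. ?h (x, t) * indicator {l / 2..r + 1} t) = (\<lambda>t. ?h (x, t))"
    proof
      fix t
      have "?h (x, t) = 0" if "t \<notin> {l / 2..r + 1}"
      proof -
        have "(x, t) \<notin> ?K" using that R(1) by auto
        then show ?thesis using R'[of "(x, t)"] by simp
      qed
      then show "?h (x, t) * indicator {l / 2..r + 1} t = ?h (x, t)"
        by (cases "t \<in> {l / 2..r + 1}") auto
    qed
    finally show ?thesis .
  qed
  have "(\<integral>z. ?h z \<partial>(lborel \<Otimes>\<^sub>M lborel)) = (\<integral>x. (\<integral>t. ?h (x, t) \<partial>lborel) \<partial>lborel)"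
    using lborel_pair.integral_fst'[OF h] by simp
  then have "(\<integral>z. ?h z \<partial>lborel) = 0"
    unfolding inner by (simp add: lborel_prod)
  then have "(\<integral>z. ?f z \<partial>lborel) = - (\<integral>z. ?g z \<partial>lborel)"
    using f g by simp
  moreover have "(LINT (x, t):Q_plus|lebesgue. u x t * time_deriv \<phi> (x, t)) = (\<integral>z. ?f z \<partial>lborel)"
    using R(1) by (intro set_integral_Q_plus_lborel R') auto
  moreover have "(LINT (x, t):Q_plus|lebesgue. v x t * \<phi> (x, t)) = (\<integral>z. ?g z \<partial>lborel)"
    using R(1) by (intro set_integral_Q_plus_lborel R') auto
  ultimately show ?thesis by simp
qed

section \<open>Functions that are nondecreasing in the sense of distributions\<close>

lemma ball_bump_translate: "ball_bump a \<delta> x = ball_bump 0 \<delta> (x - a)"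
  by (simp add: ball_bump_def)

lemma ball_bump_continuous: "continuous_on UNIV (ball_bump a \<delta> :: 'a::euclidean_space \<Rightarrow> real)"
proof -
  have "C_k 0 (\<lambda>z::'a. ball_bump a \<delta> z)" by (rule ball_bump_smooth) blast
  then show ?thesis by simp
qed

lemma ball_bump_borel [measurable]: "(ball_bump a \<delta> :: 'a::euclidean_space \<Rightarrow> real) \<in> borel_measurable borel"
  by (rule borel_measurable_continuous_onI[OF ball_bump_continuous])

lemma ball_bump_le_1: "ball_bump a \<delta> x \<le> 1"
  by (simp add: ball_bump_def flat_def)

lemma ball_bump_integrable:
  fixes a :: "'a::euclidean_space"
  assumes "\<delta> > 0"
  shows "integrable lborel (ball_bump a \<delta>)"
proof (rule integrable_compact_support)
  show "compact (cball a \<delta>)" by simp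
  show "\<bar>ball_bump a \<delta> z\<bar> \<le> 1" for z
    using ball_bump_nonneg[of a \<delta> z] ball_bump_le_1[of a \<delta> z] by simp
  show "ball_bump a \<delta> z = 0" if "z \<notin> cball a \<delta>" for z
    using that by (intro ball_bump_eq_0 assms) (simp add: dist_norm norm_minus_commute)
qed simp

lemma ball_bump_integral_pos:
  fixes a :: "'a::euclidean_space"
  assumes "\<delta> > 0"
  shows "(\<integral>x. ball_bump a \<delta> x \<partial>lborel) > 0"
proof (rule ccontr)
  assume "\<not> ?thesis"
  moreover have "(\<integral>x. ball_bump a \<delta> x \<partial>lborel) \<ge> 0"
    by (intro integral_nonneg_AE) (simp add: ball_bump_nonneg)
  ultimately have "(\<integral>x. ball_bump a \<delta> x \<partial>lborel) = 0" by simp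
  then have ae: "AE x in lborel. ball_bump a \<delta> x = 0"
    using integral_nonneg_eq_0_iff_AE[OF ball_bump_integrable[OF assms, of a]]
    by (simp add: ball_bump_nonneg)
  have "AE x in lborel. x \<notin> ball a \<delta>"
    using ae
  proof eventually_elim
    case (elim x)
    with ball_bump_pos_iff[OF assms, of a x] show ?case
      by (simp add: dist_norm norm_minus_commute)
  qed
  then have "ball a \<delta> \<in> null_sets lborel"
    by (subst (asm) AE_iff_null_sets[symmetric]) auto
  then have "negligible (ball a \<delta>)"
    by (simp add: negligible_iff_null_sets null_sets_completionI)
  then show False using assms open_not_negligible[of "ball a \<delta>"] by simp
qed

text \<open>
  Near \<open>s\<close> the function \<open>\<eta>\<close> steps up and near \<open>r\<close> it steps down again. With \<open>\<Theta>\<close> an antiderivative of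
  the bump at \<open>0\<close>, it is \<open>\<Theta> (t - s) - \<Theta> (t - r)\<close>; this is nonnegative because \<open>\<Theta>\<close> is monotone and
  \<open>s < r\<close>, and zero away from \<open>{s..r}\<close> because \<open>\<Theta>\<close> is constant on either side of the bump.
\<close>

lemma smooth_step_difference:
  fixes s r \<epsilon> :: real
  assumes "s < r" and "\<epsilon> > 0"
  obtains \<eta> where "\<forall>k. C_k k \<eta>" "\<And>t. \<eta> t \<ge> 0" "\<And>t. t \<notin> {s - \<epsilon>..r + \<epsilon>} \<Longrightarrow> \<eta> t = 0"
    "\<And>t. (\<eta> has_real_derivative (ball_bump s \<epsilon> t - ball_bump r \<epsilon> t)) (at t)"
proof -
  let ?\<beta> = "ball_bump 0 \<epsilon> :: real \<Rightarrow> real"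
  have c: "isCont ?\<beta> t" for t
    using ball_bump_continuous[of "0::real" \<epsilon>] by (auto simp: continuous_on_eq_continuous_at)
  obtain \<Theta> where "\<And>t. - \<infinity> < ereal t \<Longrightarrow> ereal t < \<infinity> \<Longrightarrow> (\<Theta> has_vector_derivative ?\<beta> t) (at t)"
    using einterval_antiderivative[of "- \<infinity>" "\<infinity>" ?\<beta>] c by auto
  then have \<Theta>: "(\<Theta> has_real_derivative ?\<beta> t) (at t)" for t
    by (simp add: has_real_derivative_iff_has_vector_derivative)
  have mono: "\<Theta> x \<le> \<Theta> y" if "x \<le> y" for x y
    using \<Theta> ball_bump_nonneg by (intro DERIV_nonneg_imp_nondecreasing[OF that]) blast
  have const: "\<Theta> x = \<Theta> y" if "x \<le> y" "\<And>t. x \<le> t \<Longrightarrow> t \<le> y \<Longrightarrow> \<epsilon> \<le> \<bar>t\<bar>" for x y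
  proof (rule antisym)
    have "?\<beta> t = 0" if "x \<le> t" "t \<le> y" for t
      using \<open>\<And>t. x \<le> t \<Longrightarrow> t \<le> y \<Longrightarrow> \<epsilon> \<le> \<bar>t\<bar>\<close>[OF that] assms(2) by (intro ball_bump_eq_0) auto
    then show "\<Theta> y \<le> \<Theta> x"
      using \<Theta> by (intro DERIV_nonpos_imp_nonincreasing[OF \<open>x \<le> y\<close>]) (metis order_refl)
  qed (rule mono[OF \<open>x \<le> y\<close>])
  have d: "((\<lambda>t. \<Theta> (t - s) - \<Theta> (t - r)) has_real_derivative (ball_bump s \<epsilon> t - ball_bump r \<epsilon> t)) (at t)" for t
    unfolding ball_bump_translate[of s] ball_bump_translate[of r]
    by (auto intro!: derivative_eq_intros DERIV_chain2[OF \<Theta>])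
  have "\<forall>k. C_k k (ball_bump q \<epsilon> :: real \<Rightarrow> real)" for q :: real
    by (intro allI ball_bump_smooth) blast
  then have "\<forall>k. C_k k (\<lambda>t. ball_bump s \<epsilon> t + (- 1) * ball_bump r \<epsilon> t)"
    by (intro allI C_k_add C_k_mult C_k_const) auto
  then have "\<forall>k. C_k k (\<lambda>t. \<Theta> (t - s) - \<Theta> (t - r))"
    by (intro smooth_antiderivative[OF _ d]) simp
  moreover have "\<Theta> (t - s) - \<Theta> (t - r) \<ge> 0" for t
    using mono[of "t - r" "t - s"] assms(1) by simp
  moreover have "\<Theta> (t - s) - \<Theta> (t - r) = 0" if "t \<notin> {s - \<epsilon>..r + \<epsilon>}" for t
    using const[of "t - r" "t - s"] assms that by force
  ultimately show ?thesis using d by (rule that)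
qed

text \<open>
  If \<open>Q a r < c1 < c2 < Q a s\<close> with \<open>s < r\<close>, then \<open>Q > c2\<close> near \<open>(a,s)\<close> and \<open>Q < c1\<close> near \<open>(a,r)\<close>.
  Choose \<open>\<eta>\<close> with \<open>\<eta>'\<close> equal to a bump at \<open>s\<close> minus the same bump at \<open>r\<close>. The two products with a
  bump in space have the same integral \<open>I > 0\<close>, so testing \<open>Q\<close> with \<open>\<eta>'\<close> gives at least
  \<open>(c2 - c1) I > 0\<close>, contrary to the assumption. Continuity of \<open>Q\<close> makes the conclusion
  hold at every point rather than almost everywhere.
\<close>

lemma nondecreasing_of_weak_derivative_nonneg:
  fixes Q :: "'a::euclidean_space \<Rightarrow> real \<Rightarrow> real"
  assumes cont: "continuous_on UNIV (\<lambda>z. Q (fst z) (snd z))"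
    and weak: "\<And>\<delta> \<eta> \<eta>' l r. \<lbrakk>\<delta> > 0; \<forall>k. C_k k \<eta>; \<And>t. \<eta> t \<ge> 0; l > 0; \<And>t. t \<notin> {l..r} \<Longrightarrow> \<eta> t = 0;
        \<And>t. (\<eta> has_real_derivative \<eta>' t) (at t)\<rbrakk> \<Longrightarrow>
        (\<integral>z. Q (fst z) (snd z) * (ball_bump a \<delta> (fst z) * \<eta>' (snd z)) \<partial>lborel) \<le> 0"
    and "0 < s" "s < r"
  shows "Q a s \<le> Q a r"
proof (rule ccontr)
  assume "\<not> ?thesis"
  then obtain c2 where c2: "Q a r < c2" "c2 < Q a s" using dense by (metis not_le)
  then obtain c1 where c1: "Q a r < c1" "c1 < c2" using dense by metis
  have near: "\<exists>\<delta>>0. \<forall>x t. norm (x - a) < \<delta> \<longrightarrow> \<bar>t - q\<bar> < \<delta> \<longrightarrow> (x, t) \<in> S"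
    if "open S" "(a, q) \<in> S" for S q
  proof -
    from open_prod_elim[OF that] obtain A B where
      AB: "open A" "open B" "(a, q) \<in> A \<times> B" "A \<times> B \<subseteq> S" by blast
    then obtain d1 d2 where "d1 > 0" "ball a d1 \<subseteq> A" "d2 > 0" "ball q d2 \<subseteq> B"
      unfolding open_contains_ball by (metis mem_Sigma_iff)
    then show ?thesis using AB(4)
      by (intro exI[of _ "min d1 d2"]) (auto simp: subset_iff dist_norm norm_minus_commute abs_minus_commute)
  qed
  have "open {z. Q (fst z) (snd z) < c1}" "open {z. c2 < Q (fst z) (snd z)}"
    using cont by (intro open_Collect_less continuous_on_const; simp)+
  then obtain \<delta>1 \<delta>2 where
    \<delta>1: "\<delta>1 > 0" "\<And>x t. norm (x - a) < \<delta>1 \<Longrightarrow> \<bar>t - r\<bar> < \<delta>1 \<Longrightarrow> Q x t < c1" and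
    \<delta>2: "\<delta>2 > 0" "\<And>x t. norm (x - a) < \<delta>2 \<Longrightarrow> \<bar>t - s\<bar> < \<delta>2 \<Longrightarrow> c2 < Q x t"
    using near[of "{z. Q (fst z) (snd z) < c1}" r] near[of "{z. c2 < Q (fst z) (snd z)}" s] c1 c2
    by auto
  \<comment> \<open>The bound \<open>s / 2\<close> keeps the support of the step inside \<open>{0<..}\<close>.\<close>
  define \<delta> where "\<delta> = min (min \<delta>1 \<delta>2) (s / 2)"
  have \<delta>: "\<delta> > 0" "\<delta> \<le> \<delta>1" "\<delta> \<le> \<delta>2" "\<delta> < s"
    using \<delta>1(1) \<delta>2(1) \<open>0 < s\<close> by (auto simp: \<delta>_def)
  obtain \<eta> where \<eta>: "\<forall>k. C_k k \<eta>" "\<And>t. \<eta> t \<ge> 0" "\<And>t. t \<notin> {s - \<delta>..r + \<delta>} \<Longrightarrow> \<eta> t = 0"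
    "\<And>t. (\<eta> has_real_derivative (ball_bump s \<delta> t - ball_bump r \<delta> t)) (at t)"
    using smooth_step_difference[OF \<open>s < r\<close> \<open>\<delta> > 0\<close>] by blast
  define w where "w = (\<lambda>q (z :: 'a \<times> real). ball_bump a \<delta> (fst z) * ball_bump q \<delta> (snd z))"
  have w_borel [measurable]: "w q \<in> borel_measurable borel" for q
    unfolding w_def
    by (intro borel_measurable_continuous_onI continuous_on_mult
        continuous_on_compose2[OF ball_bump_continuous] continuous_on_fst continuous_on_snd continuous_on_id) auto
  have [measurable]: "(\<lambda>z. Q (fst z) (snd z)) \<in> borel_measurable borel"
    by (rule borel_measurable_continuous_onI[OF cont])
  have w_nonneg: "w q z \<ge> 0" for q z
    unfolding w_def by (intro mult_nonneg_nonneg ball_bump_nonneg)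
  have w_le: "w q z \<le> 1" for q z
    unfolding w_def by (intro mult_le_one ball_bump_le_1 ball_bump_nonneg)
  have w_supp: "norm (fst z - a) < \<delta> \<and> \<bar>snd z - q\<bar> < \<delta>" if "w q z \<noteq> 0" for q z
    using that ball_bump_eq_0[OF \<open>\<delta> > 0\<close>, of "fst z" a] ball_bump_eq_0[OF \<open>\<delta> > 0\<close>, of "snd z" q]
    unfolding w_def by (auto simp: not_le[symmetric])
  let ?K = "\<lambda>q. cball a \<delta> \<times> cball q \<delta> :: ('a \<times> real) set"
  have K: "compact (?K q)" for q by (intro compact_Times compact_cball)
  have w0: "w q z = 0" if "z \<notin> ?K q" for q z
    using w_supp[of q z] that
    by (cases z; cases "w q z = 0") (auto simp: dist_norm norm_minus_commute abs_minus_commute)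
  have int_w: "integrable lborel (w q)" for q
    using w_nonneg w_le w0 by (intro integrable_compact_support[OF _ K[of q], of _ 1]) auto
  have int_Qw: "integrable lborel (\<lambda>z. Q (fst z) (snd z) * w q z)" for q
  proof -
    have "bounded ((\<lambda>z. Q (fst z) (snd z)) ` ?K q)"
      by (intro compact_imp_bounded compact_continuous_image K continuous_on_subset[OF cont]) simp
    then obtain C where C: "\<And>z. z \<in> ?K q \<Longrightarrow> \<bar>Q (fst z) (snd z)\<bar> \<le> C"
      unfolding bounded_iff by (metis (no_types, lifting) image_eqI real_norm_def)
    have "\<bar>Q (fst z) (snd z) * w q z\<bar> \<le> C" if "z \<in> ?K q" for z
      using mult_mono[OF C[OF that] w_le[of q z]] C[OF that] w_nonneg[of q z]
      by (simp add: abs_mult)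
    then show ?thesis
      using w0 by (intro integrable_compact_support[OF _ K[of q], of _ C]) auto
  qed
  have I: "(\<integral>z. w q z \<partial>lborel) = (\<integral>x. ball_bump a \<delta> x \<partial>lborel) * integral\<^sup>L lborel (ball_bump (0::real) \<delta>)" for q
  proof -
    have "integral\<^sup>L lborel (ball_bump q \<delta>) = integral\<^sup>L lborel (ball_bump (0::real) \<delta>)"
      using lborel_integral_real_affine[of 1 "ball_bump q \<delta>" q] unfolding ball_bump_translate[of q] by simp
    moreover have "(\<integral>z. w q z \<partial>lborel) = (\<integral>x. (\<integral>t. w q (x, t) \<partial>lborel) \<partial>lborel)"
      using lborel_pair.integral_fst'[of "w q"] int_w[of q] by (simp add: lborel_prod)
    ultimately show ?thesis by (simp add: w_def)
  qed
  have pos: "(\<integral>z. w q z \<partial>lborel) > 0" for q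
    unfolding I using \<open>\<delta> > 0\<close> by (intro mult_pos_pos ball_bump_integral_pos)
  have "(\<integral>z. Q (fst z) (snd z) * (ball_bump a \<delta> (fst z) * (ball_bump s \<delta> (snd z) - ball_bump r \<delta> (snd z))) \<partial>lborel) \<le> 0"
    using \<delta>(4) by (intro weak[OF \<open>\<delta> > 0\<close> \<eta>(1,2) _ \<eta>(3,4)]) auto
  then have "(\<integral>z. Q (fst z) (snd z) * w s z - Q (fst z) (snd z) * w r z \<partial>lborel) \<le> 0"
    by (simp add: w_def algebra_simps)
  then have "(\<integral>z. Q (fst z) (snd z) * w s z \<partial>lborel) \<le> (\<integral>z. Q (fst z) (snd z) * w r z \<partial>lborel)"
    using int_Qw by simp
  moreover have "(\<integral>z. c2 * w s z \<partial>lborel) \<le> (\<integral>z. Q (fst z) (snd z) * w s z \<partial>lborel)"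
  proof (rule integral_mono)
    show "c2 * w s z \<le> Q (fst z) (snd z) * w s z" for z
      using w_supp[of s z] \<delta>2(2)[of "fst z" "snd z"] \<delta>(3) w_nonneg[of s z]
      by (cases "w s z = 0") (auto intro!: mult_right_mono)
  qed (use int_w int_Qw in auto)
  moreover have "(\<integral>z. Q (fst z) (snd z) * w r z \<partial>lborel) \<le> (\<integral>z. c1 * w r z \<partial>lborel)"
  proof (rule integral_mono)
    show "Q (fst z) (snd z) * w r z \<le> c1 * w r z" for z
      using w_supp[of r z] \<delta>1(2)[of "fst z" "snd z"] \<delta>(2) w_nonneg[of r z]
      by (cases "w r z = 0") (auto intro!: mult_right_mono)
  qed (use int_w int_Qw in auto)
  ultimately have "c2 * (\<integral>z. w s z \<partial>lborel) \<le> c1 * (\<integral>z. w r z \<partial>lborel)" by simp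
  then have "c2 * (\<integral>z. w s z \<partial>lborel) \<le> c1 * (\<integral>z. w s z \<partial>lborel)"
    unfolding I .
  with pos[of s] c1(2) show False by simp
qed

section \<open>The differential inequality in integrated form\<close>

text \<open>
  Rescaling the integral from \<open>0\<close> to \<open>t\<close> to the fixed interval \<open>{0..1}\<close> makes it defined for all real
  \<open>t\<close>, and continuous also in parameters by the theorem on integrals over a fixed box.
\<close>

lemma continuous_primitive:
  fixes g :: "real \<Rightarrow> real"
  assumes "continuous_on UNIV g"
  shows "((\<lambda>t. t * integral {0..1} (\<lambda>\<sigma>. g (\<sigma> * t))) has_real_derivative g t) (at t)"
    and "t \<ge> 0 \<Longrightarrow> integral {0..t} g = t * integral {0..1} (\<lambda>\<sigma>. g (\<sigma> * t))"
proof -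
  have "isCont g t" for t using assms by (simp add: continuous_on_eq_continuous_at)
  then obtain \<Gamma> where "\<And>t. - \<infinity> < ereal t \<Longrightarrow> ereal t < \<infinity> \<Longrightarrow> (\<Gamma> has_vector_derivative g t) (at t)"
    using einterval_antiderivative[of "- \<infinity>" "\<infinity>" g] by auto
  then have \<Gamma>: "(\<Gamma> has_real_derivative g t) (at t)" for t
    by (simp add: has_real_derivative_iff_has_vector_derivative)
  have eq: "t * integral {0..1} (\<lambda>\<sigma>. g (\<sigma> * t)) = \<Gamma> t - \<Gamma> 0" for t
  proof -
    have "((\<lambda>\<sigma>. \<sigma> * t) has_real_derivative 1 * t) (at \<sigma>)" for \<sigma>
      by (rule DERIV_cmult_right[OF DERIV_ident])
    then have "((\<lambda>\<sigma>. \<Gamma> (\<sigma> * t)) has_real_derivative g (\<sigma> * t) * (1 * t)) (at \<sigma>)" for \<sigma>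
      by (rule DERIV_chain2[OF \<Gamma>])
    then have "((\<lambda>\<sigma>. \<Gamma> (\<sigma> * t)) has_vector_derivative t * g (\<sigma> * t)) (at \<sigma> within {0..1})" for \<sigma>
      unfolding has_real_derivative_iff_has_vector_derivative[symmetric]
      by (simp add: has_field_derivative_at_within mult.commute)
    then have "((\<lambda>\<sigma>. t * g (\<sigma> * t)) has_integral \<Gamma> (1 * t) - \<Gamma> (0 * t)) {0..1}"
      by (intro fundamental_theorem_of_calculus) simp_all
    from integral_unique[OF this] show ?thesis by simp
  qed
  show "((\<lambda>t. t * integral {0..1} (\<lambda>\<sigma>. g (\<sigma> * t))) has_real_derivative g t) (at t)"
    unfolding eq using DERIV_diff[OF \<Gamma> DERIV_const[of "\<Gamma> 0"]] by simp
  show "integral {0..t} g = t * integral {0..1} (\<lambda>\<sigma>. g (\<sigma> * t))" if "t \<ge> 0"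
    unfolding eq using that \<Gamma>
    by (intro integral_unique fundamental_theorem_of_calculus)
      (auto simp: has_real_derivative_iff_has_vector_derivative[symmetric] intro: has_field_derivative_at_within)
qed

lemma exp_smooth: "C_k k (exp :: real \<Rightarrow> real)"
proof (induction k)
  case (Suc k)
  then show ?case unfolding C_k_Suc_real by (intro exI[of _ exp]) auto
qed (auto intro: continuous_intros)

lemma truncated_conv_le_conv:
  assumes "\<And>y. f y \<ge> 0" "\<And>y. J y \<ge> 0" and "conv_exists J f x"
  shows "integral (cbox a b) (\<lambda>y. J (x - y) * f y) \<le> conv J f x"
proof -
  have int: "integrable lebesgue (\<lambda>y. J (x - y) * f y)"
    using assms(3) unfolding conv_exists_def .
  have "set_integrable lebesgue (cbox a b) (\<lambda>y. J (x - y) * f y)"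
    unfolding set_integrable_def by (intro integrable_mult_indicator int) simp
  from set_lebesgue_integral_eq_integral(2)[OF this]
  have "integral (cbox a b) (\<lambda>y. J (x - y) * f y) = (LINT y:cbox a b|lebesgue. J (x - y) * f y)" by simp
  also have "\<dots> \<le> conv J f x"
    unfolding set_lebesgue_integral_def conv_def
    by (intro integral_mono integrable_mult_indicator int) (auto simp: assms indicator_def)
  finally show ?thesis .
qed

text \<open>
  The integral over the box is \<open>G\<close> below, with \<open>\<psi>\<close> continued to negative times by its values at time
  \<open>0\<close>. The function \<open>Q = e\<^sup>t \<psi> - H\<close> with \<open>H(x,t) = \<integral>\<^sub>0\<^sup>t e\<^sup>\<tau> G(x,\<tau>) d\<tau>\<close> is continuous, and
  the claim is \<open>Q(x,0) \<le> Q(x,t)\<close>. To see that its distributional time derivative is nonnegative on a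
  product \<open>\<xi> \<eta>\<close>, test the inequality for \<open>\<psi>\<close> with \<open>e\<^sup>t \<xi> \<eta>\<close>: the derivative of the factor \<open>e\<^sup>t\<close> cancels
  the term \<open>- \<psi>\<close>, the convolution is bounded below by \<open>G\<close>, and integration by parts turns
  \<open>e\<^sup>t G\<close> into the time derivative of \<open>H\<close>.
\<close>

lemma truncated_duhamel_inequality:
  fixes J :: "'a::euclidean_space \<Rightarrow> real" and \<psi> :: "'a \<Rightarrow> real \<Rightarrow> real"
  assumes J: "\<And>y. J y \<ge> 0" "continuous_on UNIV J"
    and cont: "continuous_on (UNIV \<times> {0..}) (\<lambda>(x, t). \<psi> x t)"
    and nonneg: "\<And>x t. t \<ge> 0 \<Longrightarrow> \<psi> x t \<ge> 0"
    and super: "time_deriv_ge J \<psi>"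
    and "t \<ge> 0"
  shows "(\<lambda>\<tau>. exp \<tau> * integral (cbox c d) (\<lambda>y. J (x - y) * \<psi> y \<tau>)) integrable_on {0..t}"
    and "\<psi> x 0 + integral {0..t} (\<lambda>\<tau>. exp \<tau> * integral (cbox c d) (\<lambda>y. J (x - y) * \<psi> y \<tau>)) \<le> exp t * \<psi> x t"
proof -
  define \<Psi> where "\<Psi> = (\<lambda>x t. \<psi> x (max 0 t))"
  define G where "G = (\<lambda>x t. integral (cbox c d) (\<lambda>y. J (x - y) * \<Psi> y t))"
  define H where "H = (\<lambda>x t. t * integral {0..1} (\<lambda>\<sigma>. exp (\<sigma> * t) * G x (\<sigma> * t)))"
  have cont_\<Psi>: "continuous_on UNIV (\<lambda>z. \<Psi> (fst z) (snd z))"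
  proof -
    have "continuous_on UNIV (\<lambda>z::'a \<times> real. case (fst z, max 0 (snd z)) of (x, t) \<Rightarrow> \<psi> x t)"
      by (rule continuous_on_compose2[OF cont]) (auto intro!: continuous_intros)
    then show ?thesis by (simp add: \<Psi>_def)
  qed
  have cont_G: "continuous_on UNIV (\<lambda>z. G (fst z) (snd z))"
  proof -
    have "continuous_on (UNIV \<times> cbox c d) (\<lambda>(z, y). J (fst z - y) * \<Psi> y (snd z))"
    proof -
      have "continuous_on (UNIV \<times> cbox c d) (\<lambda>p::('a \<times> real) \<times> 'a. J (fst (fst p) - snd p))"
        by (rule continuous_on_compose2[OF J(2)]) (auto intro!: continuous_intros)
      moreover have "continuous_on (UNIV \<times> cbox c d)
          (\<lambda>p::('a \<times> real) \<times> 'a. \<Psi> (fst (snd p, snd (fst p))) (snd (snd p, snd (fst p))))"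
        by (rule continuous_on_compose2[OF cont_\<Psi>]) (auto intro!: continuous_intros)
      ultimately show ?thesis
        unfolding case_prod_unfold fst_conv snd_conv by (rule continuous_on_mult)
    qed
    then show ?thesis unfolding G_def by (rule integral_continuous_on_param)
  qed
  have cont_H: "continuous_on UNIV (\<lambda>z. H (fst z) (snd z))"
  proof -
    have "continuous_on (UNIV \<times> cbox 0 1) (\<lambda>(z, \<sigma>). exp (\<sigma> * snd z) * G (fst z) (\<sigma> * snd z))"
    proof -
      have "continuous_on (UNIV \<times> cbox 0 1) (\<lambda>p::('a \<times> real) \<times> real. exp (snd p * snd (fst p)))"
        by (intro continuous_intros)
      moreover have "continuous_on (UNIV \<times> cbox 0 1) (\<lambda>p::('a \<times> real) \<times> real.
          G (fst (fst (fst p), snd p * snd (fst p))) (snd (fst (fst p), snd p * snd (fst p))))"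
        by (rule continuous_on_compose2[OF cont_G]) (auto intro!: continuous_intros)
      ultimately show ?thesis
        unfolding case_prod_unfold fst_conv snd_conv by (rule continuous_on_mult)
    qed
    then have "continuous_on UNIV (\<lambda>z. integral (cbox 0 1) (\<lambda>\<sigma>. exp (\<sigma> * snd z) * G (fst z) (\<sigma> * snd z)))"
      by (rule integral_continuous_on_param)
    then show ?thesis unfolding H_def by (auto intro!: continuous_intros)
  qed
  have cont_section: "continuous_on UNIV (\<lambda>t. exp t * G x t)" for x
  proof -
    have "continuous_on UNIV (\<lambda>t. G (fst (x, t)) (snd (x, t)))"
      by (rule continuous_on_compose2[OF cont_G]) (auto intro!: continuous_intros)
    then show ?thesis by (auto intro!: continuous_intros)
  qed
  have deriv_H: "(H x has_real_derivative exp t * G x t) (at t)" for x t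
    unfolding H_def using continuous_primitive(1)[OF cont_section] .
  have H_eq: "H x t = integral {0..t} (\<lambda>\<tau>. exp \<tau> * G x \<tau>)" if "t \<ge> 0" for x t
    unfolding H_def using continuous_primitive(2)[OF cont_section that] by simp
  define Q where "Q = (\<lambda>x t. exp t * \<Psi> x t - H x t)"
  have cont_Q: "continuous_on UNIV (\<lambda>z. Q (fst z) (snd z))"
    unfolding Q_def using cont_\<Psi> cont_H by (intro continuous_intros) auto
  have mono: "Q a s \<le> Q a r" if "0 < s" "s < r" for a s r
  proof (rule nondecreasing_of_weak_derivative_nonneg[OF cont_Q _ that])
    fix \<delta> l r :: real and \<eta> \<eta>' :: "real \<Rightarrow> real"
    assume "\<delta> > 0" and \<eta>: "\<forall>k. C_k k \<eta>" and \<eta>_nonneg: "\<And>t. \<eta> t \<ge> 0" and "l > 0"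
      and \<eta>_supp: "\<And>t. t \<notin> {l..r} \<Longrightarrow> \<eta> t = 0"
      and \<eta>': "\<And>t. (\<eta> has_real_derivative \<eta>' t) (at t)"
    define \<xi> where "\<xi> = (ball_bump a \<delta> :: 'a \<Rightarrow> real)"
    have \<xi>_nonneg: "\<xi> x \<ge> 0" for x by (simp add: \<xi>_def ball_bump_nonneg)
    \<comment> \<open>The test function \<open>\<phi>1\<close> is used for \<open>H\<close>, and \<open>\<phi>2\<close> for the inequality satisfied by \<open>\<psi>\<close>.\<close>
    define \<phi>1 where "\<phi>1 = (\<lambda>(x, t). \<xi> x * \<eta> t)"
    define \<phi>2 where "\<phi>2 = (\<lambda>(x, t). \<xi> x * (exp t * \<eta> t))"
    have test1: "test_function \<phi>1"
      unfolding \<phi>1_def \<xi>_def by (rule test_function_product[OF \<open>\<delta> > 0\<close> \<eta> \<open>l > 0\<close> \<eta>_supp])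
    have "\<forall>k. C_k k (\<lambda>t. exp t * \<eta> t)"
      using \<eta> by (intro allI C_k_mult exp_smooth) auto
    then have test2: "test_function \<phi>2"
      unfolding \<phi>2_def \<xi>_def
      by (rule test_function_product[OF \<open>\<delta> > 0\<close> _ \<open>l > 0\<close>, of _ r]) (simp add: \<eta>_supp)
    have td1: "time_deriv \<phi>1 z = \<xi> (fst z) * \<eta>' (snd z)" for z
      unfolding time_deriv_def \<phi>1_def case_prod_unfold
      by (auto intro!: DERIV_imp_deriv derivative_eq_intros \<eta>')
    have td2: "time_deriv \<phi>2 z = \<xi> (fst z) * (exp (snd z) * \<eta> (snd z) + exp (snd z) * \<eta>' (snd z))" for z
      unfolding time_deriv_def \<phi>2_def case_prod_unfold
      by (auto intro!: DERIV_imp_deriv derivative_eq_intros \<eta>' simp: algebra_simps)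
    define K where "K = cball a \<delta> \<times> {l..r}"
    have K: "compact K" "K \<subseteq> Q_plus"
      unfolding K_def using \<open>l > 0\<close> by (auto intro!: compact_Times)
    have \<xi>0: "\<xi> x = 0" if "x \<notin> cball a \<delta>" for x
      unfolding \<xi>_def using that by (intro ball_bump_eq_0 \<open>\<delta> > 0\<close>) (simp add: dist_norm norm_minus_commute)
    have \<eta>'0: "\<eta>' t = 0" if "t \<notin> {l..r}" for t
    proof -
      have "open (- {l..r})" by (simp add: open_Compl)
      then have "(\<eta> has_real_derivative 0) (at t)"
        using that by (intro has_field_derivative_transform_within_open[OF DERIV_const[of 0], of "- {l..r}"])
          (auto simp: \<eta>_supp)
      then show ?thesis using \<eta>' DERIV_unique by blast
    qed
    have zero: "\<xi> (fst z) * \<eta> (snd z) = 0" "\<xi> (fst z) * \<eta>' (snd z) = 0" if "z \<notin> K" for z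
      using that \<xi>0[of "fst z"] \<eta>_supp[of "snd z"] \<eta>'0[of "snd z"] unfolding K_def
      by (cases z; force)+
    have c1: "continuous_on UNIV \<xi>" unfolding \<xi>_def by (rule ball_bump_continuous)
    have c2: "continuous_on UNIV \<eta>" using C_k_continuous \<eta> by blast
    have c3: "continuous_on UNIV \<eta>'" using C_k_continuous smooth_derivative[OF \<eta> \<eta>'] by blast
    have cont_\<xi>\<eta>: "continuous_on UNIV (\<lambda>z. \<xi> (fst z))" "continuous_on UNIV (\<lambda>z::'a \<times> real. \<eta> (snd z))"
        "continuous_on UNIV (\<lambda>z::'a \<times> real. \<eta>' (snd z))"
      by (rule continuous_on_compose2[OF c1] continuous_on_compose2[OF c2] continuous_on_compose2[OF c3],
          intro continuous_on_fst continuous_on_snd continuous_on_id, simp)+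
    note cont_intros = continuous_on_mult continuous_on_add continuous_on_diff cont_\<xi>\<eta> cont_\<Psi> cont_G cont_H
      continuous_on_exp continuous_on_snd continuous_on_id
    have int: "integrable lborel h" if "continuous_on UNIV h" "\<And>z. z \<notin> K \<Longrightarrow> h z = 0" for h :: "'a \<times> real \<Rightarrow> real"
      using that K(1) by (intro integrable_continuous_compact_support)
    have i1: "integrable lborel (\<lambda>z. exp (snd z) * \<Psi> (fst z) (snd z) * (\<xi> (fst z) * \<eta>' (snd z)))"
      by (intro int cont_intros) (simp add: zero)
    have i2: "integrable lborel (\<lambda>z. H (fst z) (snd z) * (\<xi> (fst z) * \<eta>' (snd z)))"
      by (intro int cont_intros) (simp add: zero)
    have i3: "integrable lborel (\<lambda>z. exp (snd z) * G (fst z) (snd z) * (\<xi> (fst z) * \<eta> (snd z)))"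
      by (intro int cont_intros) (simp add: zero)
    have i4: "integrable lborel (\<lambda>z. exp (snd z) * \<Psi> (fst z) (snd z) * (\<xi> (fst z) * \<eta> (snd z)))"
      by (intro int cont_intros) (simp add: zero)
    have b1: "(\<lambda>z. H (fst z) (snd z)) \<in> borel_measurable borel"
      "(\<lambda>z. exp (snd z) * G (fst z) (snd z)) \<in> borel_measurable borel"
      "(\<lambda>z. \<Psi> (fst z) (snd z)) \<in> borel_measurable borel"
      by (intro borel_measurable_continuous_onI cont_intros)+
    have c\<phi>: "continuous_on UNIV \<phi>1" "continuous_on UNIV \<phi>2"
      using test1 test2 C_k_continuous unfolding test_function_def by blast+
    have b2: "\<phi>1 \<in> borel_measurable borel" "\<phi>2 \<in> borel_measurable borel"
      "time_deriv \<phi>1 \<in> borel_measurable borel" "time_deriv \<phi>2 \<in> borel_measurable borel"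
      using c\<phi> test_function_time_derivative(2)[OF test1] test_function_time_derivative(2)[OF test2]
      by (auto intro: borel_measurable_continuous_onI)
    have off: "z \<notin> K" if "z \<notin> Q_plus" for z using that K(2) by blast
    have \<phi>1_eq: "\<phi>1 z = \<xi> (fst z) * \<eta> (snd z)" and \<phi>2_eq: "\<phi>2 z = exp (snd z) * (\<xi> (fst z) * \<eta> (snd z))" for z
      by (auto simp: \<phi>1_def \<phi>2_def case_prod_unfold)
    have td2': "time_deriv \<phi>2 z = exp (snd z) * (\<xi> (fst z) * \<eta> (snd z)) + exp (snd z) * (\<xi> (fst z) * \<eta>' (snd z))" for z
      unfolding td2 by (simp add: algebra_simps)
    have vanish: "\<phi>1 z = 0" "\<phi>2 z = 0" "time_deriv \<phi>1 z = 0" "time_deriv \<phi>2 z = 0" if "z \<notin> K" for z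
      unfolding \<phi>1_eq \<phi>2_eq td1 td2' zero[OF that] by simp_all

    have ibp: "(\<integral>z. H (fst z) (snd z) * (\<xi> (fst z) * \<eta>' (snd z)) \<partial>lborel) =
      - (\<integral>z. exp (snd z) * G (fst z) (snd z) * (\<xi> (fst z) * \<eta> (snd z)) \<partial>lborel)"
    proof -
      have "(LINT (x, t):Q_plus|lebesgue. H x t * time_deriv \<phi>1 (x, t)) =
        - (LINT (x, t):Q_plus|lebesgue. exp t * G x t * \<phi>1 (x, t))"
      proof (rule integration_by_parts_test_function[OF test1])
        show "isCont (\<lambda>t. exp t * G x t) t" for x t
          using cont_section[of x] by (simp add: continuous_on_eq_continuous_at)
        fix R l r :: real
        have "compact (cball 0 R \<times> {l..r} :: ('a \<times> real) set)" by (intro compact_Times) auto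
        then have "bounded ((\<lambda>z. H (fst z) (snd z)) ` (cball 0 R \<times> {l..r}))"
          "bounded ((\<lambda>z. exp (snd z) * G (fst z) (snd z)) ` (cball 0 R \<times> {l..r}))"
          by (auto intro!: compact_imp_bounded compact_continuous_image continuous_on_subset[of UNIV] cont_intros)
        then obtain C1 C2 where "\<And>z. z \<in> cball 0 R \<times> {l..r} \<Longrightarrow> \<bar>H (fst z) (snd z)\<bar> \<le> C1"
            "\<And>z. z \<in> cball 0 R \<times> {l..r} \<Longrightarrow> \<bar>exp (snd z) * G (fst z) (snd z)\<bar> \<le> C2"
          unfolding bounded_iff by (metis (no_types, lifting) image_eqI real_norm_def)
        then show "\<exists>C. \<forall>x\<in>cball 0 R. \<forall>t\<in>{l..r}. \<bar>H x t\<bar> \<le> C \<and> \<bar>exp t * G x t\<bar> \<le> C"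
          by (intro exI[of _ "max C1 C2"]) (force simp: le_max_iff_disj)
      qed (use b1 deriv_H in auto)
      moreover have "(LINT (x, t):Q_plus|lebesgue. H x t * time_deriv \<phi>1 (x, t)) =
          (\<integral>z. H (fst z) (snd z) * time_deriv \<phi>1 z \<partial>lborel)"
        by (intro set_integral_Q_plus_lborel b1 b2 vanish off)
      moreover have "(LINT (x, t):Q_plus|lebesgue. exp t * G x t * \<phi>1 (x, t)) =
          (\<integral>z. exp (snd z) * G (fst z) (snd z) * \<phi>1 z \<partial>lborel)"
        by (intro set_integral_Q_plus_lborel b1 b2 vanish off)
      ultimately show ?thesis unfolding td1 \<phi>1_eq by (simp only:)
    qed

    have "(LINT (x, t):Q_plus|lebesgue. \<psi> x t * time_deriv \<phi>2 (x, t)) =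
        (LINT (x, t):Q_plus|lebesgue. \<Psi> x t * time_deriv \<phi>2 (x, t))"
      unfolding set_lebesgue_integral_def
      by (intro Bochner_Integration.integral_cong) (auto simp: \<Psi>_def indicator_def)
    also have "\<dots> = (\<integral>z. \<Psi> (fst z) (snd z) * time_deriv \<phi>2 z \<partial>lborel)"
      by (intro set_integral_Q_plus_lborel b1 b2 vanish off)
    also have "\<dots> = (\<integral>z. exp (snd z) * \<Psi> (fst z) (snd z) * (\<xi> (fst z) * \<eta> (snd z)) +
        exp (snd z) * \<Psi> (fst z) (snd z) * (\<xi> (fst z) * \<eta>' (snd z)) \<partial>lborel)"
      unfolding td2' by (simp add: algebra_simps)
    also have "\<dots> = (\<integral>z. exp (snd z) * \<Psi> (fst z) (snd z) * (\<xi> (fst z) * \<eta> (snd z)) \<partial>lborel) +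
        (\<integral>z. exp (snd z) * \<Psi> (fst z) (snd z) * (\<xi> (fst z) * \<eta>' (snd z)) \<partial>lborel)"
      using i4 i1 by (rule Bochner_Integration.integral_add)
    finally have lhs: "(LINT (x, t):Q_plus|lebesgue. \<psi> x t * time_deriv \<phi>2 (x, t)) = \<dots>" .

    let ?c = "\<lambda>z. conv J (\<lambda>y. \<psi> y (snd z)) (fst z)"
    obtain D where D: "\<And>z. \<bar>\<phi>2 z\<bar> \<le> D" by (rule test_function_bounded[OF test2]) blast
    have "(\<lambda>(x, t). conv J (\<lambda>y. \<psi> y t) x) absolutely_integrable_on K"
      using super K unfolding time_deriv_ge_def space_conv_L1_loc_def L1_loc_def by blast
    then have ic: "integrable lebesgue (\<lambda>z. indicator K z * ?c z)"
      unfolding set_integrable_def case_prod_unfold by simp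
    have ic\<phi>: "integrable lebesgue (\<lambda>z. indicator K z * ?c z * \<phi>2 z)"
    proof (rule Bochner_Integration.integrable_bound)
      show "integrable lebesgue (\<lambda>z. D * (indicator K z * ?c z))" using ic by simp
      have "\<phi>2 \<in> borel_measurable lebesgue" using b2(2) by (simp add: measurable_completion)
      then show "(\<lambda>z. indicator K z * ?c z * \<phi>2 z) \<in> borel_measurable lebesgue"
        by (rule borel_measurable_times[OF borel_measurable_integrable[OF ic]])
      show "AE z in lebesgue. norm (indicator K z * ?c z * \<phi>2 z) \<le> norm (D * (indicator K z * ?c z))"
      proof (rule AE_I2)
        fix z
        have "\<bar>\<phi>2 z\<bar> \<le> \<bar>D\<bar>" using D[of z] by linarith
        then show "norm (indicator K z * ?c z * \<phi>2 z) \<le> norm (D * (indicator K z * ?c z))"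
          by (simp add: abs_mult mult.commute mult_right_mono)
      qed
    qed
    have leb: "integrable lebesgue h" "integral\<^sup>L lebesgue h = integral\<^sup>L lborel h"
      if "integrable lborel h" for h :: "'a \<times> real \<Rightarrow> real"
      using that integrable_completion[of h lborel] integral_completion[of h lborel] by auto
    have Q_int: "(LINT (x, t):Q_plus|lebesgue. (conv J (\<lambda>y. \<psi> y t) x - \<psi> x t) * \<phi>2 (x, t)) =
        (\<integral>z. indicator K z * ?c z * \<phi>2 z - exp (snd z) * \<Psi> (fst z) (snd z) * (\<xi> (fst z) * \<eta> (snd z)) \<partial>lebesgue)"
      unfolding set_lebesgue_integral_def
    proof (intro Bochner_Integration.integral_cong refl)
      fix z :: "'a \<times> real"
      show "indicator Q_plus z *\<^sub>R (case z of (x, t) \<Rightarrow> (conv J (\<lambda>y. \<psi> y t) x - \<psi> x t) * \<phi>2 (x, t)) =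
        indicator K z * ?c z * \<phi>2 z - exp (snd z) * \<Psi> (fst z) (snd z) * (\<xi> (fst z) * \<eta> (snd z))"
      proof (cases "z \<in> K")
        case True
        with K(2) have "z \<in> Q_plus" by blast
        with True show ?thesis
          by (auto simp: \<phi>2_eq \<Psi>_def case_prod_unfold algebra_simps)
      next
        case False
        then show ?thesis
          using vanish(2)[OF False] zero(1)[OF False] by (simp add: case_prod_unfold)
      qed
    qed
    have "(\<integral>z. exp (snd z) * G (fst z) (snd z) * (\<xi> (fst z) * \<eta> (snd z)) \<partial>lborel) =
        (\<integral>z. exp (snd z) * G (fst z) (snd z) * (\<xi> (fst z) * \<eta> (snd z)) \<partial>lebesgue)"
      by (rule leb(2)[OF i3, symmetric])
    also have "\<dots> \<le> (\<integral>z. indicator K z * ?c z * \<phi>2 z \<partial>lebesgue)"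
    proof (rule integral_mono_AE[OF leb(1)[OF i3] ic\<phi>])
      have "AE z in lebesgue. snd z > 0 \<longrightarrow> conv_exists J (\<lambda>y. \<psi> y (snd z)) (fst z)"
        using super unfolding time_deriv_ge_def space_conv_L1_loc_def case_prod_unfold by blast
      then show "AE z in lebesgue. exp (snd z) * G (fst z) (snd z) * (\<xi> (fst z) * \<eta> (snd z)) \<le>
          indicator K z * ?c z * \<phi>2 z"
      proof eventually_elim
        case (elim z)
        show ?case
        proof (cases "z \<in> K")
          case True
          with K(2) have pos: "snd z > 0" by auto
          have "G (fst z) (snd z) \<le> ?c z"
            using truncated_conv_le_conv[of "\<lambda>y. \<psi> y (snd z)" J "fst z" c d] elim pos J(1) nonneg
            by (simp add: G_def \<Psi>_def)
          then have "G (fst z) (snd z) * \<phi>2 z \<le> ?c z * \<phi>2 z"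
            unfolding \<phi>2_eq by (intro mult_right_mono mult_nonneg_nonneg \<xi>_nonneg \<eta>_nonneg) auto
          then show ?thesis using True by (simp add: \<phi>2_eq algebra_simps)
        next
          case False
          then show ?thesis by (simp add: zero)
        qed
      qed
    qed
    also have "\<dots> = (LINT (x, t):Q_plus|lebesgue. (conv J (\<lambda>y. \<psi> y t) x - \<psi> x t) * \<phi>2 (x, t)) +
        (\<integral>z. exp (snd z) * \<Psi> (fst z) (snd z) * (\<xi> (fst z) * \<eta> (snd z)) \<partial>lborel)"
      unfolding Q_int using ic\<phi> leb[OF i4] by simp
    also have "(LINT (x, t):Q_plus|lebesgue. (conv J (\<lambda>y. \<psi> y t) x - \<psi> x t) * \<phi>2 (x, t)) \<le>
        - (LINT (x, t):Q_plus|lebesgue. \<psi> x t * time_deriv \<phi>2 (x, t))"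
    proof -
      have "\<forall>z. \<phi>2 z \<ge> 0" unfolding \<phi>2_eq using \<xi>_nonneg \<eta>_nonneg by simp
      with super test2 show ?thesis unfolding time_deriv_ge_def by blast
    qed
    finally have "(\<integral>z. exp (snd z) * G (fst z) (snd z) * (\<xi> (fst z) * \<eta> (snd z)) \<partial>lborel) \<le>
        - (\<integral>z. exp (snd z) * \<Psi> (fst z) (snd z) * (\<xi> (fst z) * \<eta>' (snd z)) \<partial>lborel)"
      unfolding lhs by simp
    then have "(\<integral>z. exp (snd z) * \<Psi> (fst z) (snd z) * (\<xi> (fst z) * \<eta>' (snd z)) \<partial>lborel) -
        (\<integral>z. H (fst z) (snd z) * (\<xi> (fst z) * \<eta>' (snd z)) \<partial>lborel) \<le> 0"
      unfolding ibp by simp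
    then have "(\<integral>z. exp (snd z) * \<Psi> (fst z) (snd z) * (\<xi> (fst z) * \<eta>' (snd z)) -
        H (fst z) (snd z) * (\<xi> (fst z) * \<eta>' (snd z)) \<partial>lborel) \<le> 0"
      using i1 i2 by simp
    then show "(\<integral>z. Q (fst z) (snd z) * (ball_bump a \<delta> (fst z) * \<eta>' (snd z)) \<partial>lborel) \<le> 0"
      by (simp add: Q_def \<xi>_def algebra_simps)
  qed
  \<comment> \<open>Test functions only see positive times; the initial time is reached by continuity.\<close>
  have "Q x 0 \<le> Q x t"
  proof (cases "t = 0")
    case False
    with \<open>t \<ge> 0\<close> have "t > 0" by simp
    have "continuous_on UNIV (\<lambda>s. Q x s)"
    proof -
      have "continuous_on UNIV (\<lambda>s. Q (fst (x, s)) (snd (x, s)))"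
        by (rule continuous_on_compose2[OF cont_Q]) (auto intro!: continuous_intros)
      then show ?thesis by simp
    qed
    then have "((\<lambda>s. Q x s) \<longlongrightarrow> Q x 0) (at_right 0)"
      by (auto simp: continuous_on_eq_continuous_at isCont_def intro: tendsto_within_subset)
    moreover have "\<forall>\<^sub>F s in at_right 0. Q x s \<le> Q x t"
      unfolding eventually_at_right_field using \<open>t > 0\<close> mono by (intro exI[of _ t]) auto
    ultimately show ?thesis by (rule tendsto_upperbound) simp
  qed simp
  moreover have "H x 0 = 0" by (simp add: H_def)
  moreover have "H x t = integral {0..t} (\<lambda>\<tau>. exp \<tau> * integral (cbox c d) (\<lambda>y. J (x - y) * \<psi> y \<tau>))"
    unfolding H_eq[OF \<open>t \<ge> 0\<close>] by (intro Henstock_Kurzweil_Integration.integral_cong) (simp add: G_def \<Psi>_def)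
  ultimately show "\<psi> x 0 + integral {0..t} (\<lambda>\<tau>. exp \<tau> * integral (cbox c d) (\<lambda>y. J (x - y) * \<psi> y \<tau>))
      \<le> exp t * \<psi> x t"
    using \<open>t \<ge> 0\<close> by (simp add: Q_def \<Psi>_def)
  have "(\<lambda>\<tau>. exp \<tau> * G x \<tau>) integrable_on {0..t}"
    by (intro integrable_continuous_interval continuous_on_subset[OF cont_section]) simp
  then show "(\<lambda>\<tau>. exp \<tau> * integral (cbox c d) (\<lambda>y. J (x - y) * \<psi> y \<tau>)) integrable_on {0..t}"
    by (rule integrable_eq) (simp add: G_def \<Psi>_def)
qed

section \<open>Iterated convolutions and the Picard bound\<close>

text \<open>
  Convolution of nonnegative functions with values in \<open>[0,\<infinity>]\<close> always exists and can be interchanged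
  with other integrals and sums. All estimates are made for it; finiteness is deduced only at the end,
  and then the results are transferred to the real-valued \<open>conv\<close>.
\<close>

definition kconv :: "('a::euclidean_space \<Rightarrow> real) \<Rightarrow> ('a \<Rightarrow> ennreal) \<Rightarrow> 'a \<Rightarrow> ennreal" where
  "kconv J f x = (\<integral>\<^sup>+y. ennreal (J (x - y)) * f y \<partial>lborel)"

lemma kconv_measurable [measurable]:
  assumes [measurable]: "J \<in> borel_measurable borel" "f \<in> borel_measurable borel"
  shows "kconv J f \<in> borel_measurable borel"
  unfolding kconv_def by measurable

lemma kconv_power_measurable [measurable]:
  assumes [measurable]: "J \<in> borel_measurable borel" "f \<in> borel_measurable borel"
  shows "(kconv J ^^ n) f \<in> borel_measurable borel"
  by (induction n) auto

lemma kconv_mono: "(\<And>y. f y \<le> g y) \<Longrightarrow> kconv J f x \<le> kconv J g x"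
  unfolding kconv_def by (intro nn_integral_mono mult_left_mono) auto

lemma kconv_power_mono: "(\<And>y. f y \<le> g y) \<Longrightarrow> (kconv J ^^ n) f x \<le> (kconv J ^^ n) g x"
  by (induction n arbitrary: x) (auto intro: kconv_mono)

lemma nn_integral_lborel_affine_reflect:
  fixes f :: "'a::euclidean_space \<Rightarrow> ennreal"
  assumes [measurable]: "f \<in> borel_measurable borel"
  shows "(\<integral>\<^sup>+y. f (x - y) \<partial>lborel) = (\<integral>\<^sup>+y. f y \<partial>lborel)"
  by (subst (2) lborel_affine[of "- 1" x]) (simp_all add: nn_integral_density nn_integral_distr)

lemma nn_integral_lborel_translate:
  fixes f :: "'a::euclidean_space \<Rightarrow> ennreal"
  assumes [measurable]: "f \<in> borel_measurable borel"
  shows "(\<integral>\<^sup>+y. f (y - x) \<partial>lborel) = (\<integral>\<^sup>+y. f y \<partial>lborel)"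
  by (subst (2) lborel_affine[of 1 "- x"]) (simp_all add: nn_integral_density nn_integral_distr)

lemma kconv_indicator_cbox:
  assumes "\<And>y. J y \<ge> 0" "\<And>y. f y \<ge> 0" "continuous_on UNIV J" "continuous_on UNIV f"
  shows "(\<integral>\<^sup>+y. ennreal (J (x - y) * f y) * indicator (cbox a b) y \<partial>lborel) =
    ennreal (integral (cbox a b) (\<lambda>y. J (x - y) * f y))"
proof (rule nn_integral_has_integral_lebesgue')
  have "continuous_on (cbox a b) (\<lambda>y. J (x - y))"
    by (rule continuous_on_compose2[OF assms(3)]) (auto intro!: continuous_intros)
  then have "(\<lambda>y. J (x - y) * f y) integrable_on cbox a b"
    by (intro integrable_continuous continuous_on_mult continuous_on_subset[OF assms(4)]) auto
  then show "((\<lambda>y. J (x - y) * f y) has_integral integral (cbox a b) (\<lambda>y. J (x - y) * f y)) (cbox a b)"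
    by (rule integrable_integral)
qed (simp add: assms)

lemma SUP_indicator_cbox: "(SUP k::nat. (c::ennreal) * indicator (cbox (- (real k *\<^sub>R One)) (real k *\<^sub>R One)) y) = c"
  for y :: "'a::euclidean_space"
proof (rule antisym)
  show "(SUP k::nat. c * indicator (cbox (- (real k *\<^sub>R One)) (real k *\<^sub>R One)) y) \<le> c"
    by (intro SUP_least) (auto simp: indicator_def)
  obtain k where k: "norm y \<le> real k" using real_arch_simple by blast
  have "y \<in> cbox (- (real k *\<^sub>R One)) (real k *\<^sub>R One)"
    using k Basis_le_norm[of _ y] by (fastforce simp: mem_box abs_le_iff)
  then show "c \<le> (SUP k::nat. c * indicator (cbox (- (real k *\<^sub>R One)) (real k *\<^sub>R One)) y)"
    by (intro SUP_upper2[of k]) auto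
qed

lemma incseq_indicator_cbox:
  "incseq (\<lambda>k::nat. \<lambda>y::'a::euclidean_space. f y * (indicator (cbox (- (real k *\<^sub>R One)) (real k *\<^sub>R One)) y :: ennreal))"
proof (intro incseq_SucI le_funI mult_left_mono)
  fix k :: nat and y :: 'a
  have "cbox (- (real k *\<^sub>R One)) (real k *\<^sub>R One) \<subseteq> (cbox (- (real (Suc k) *\<^sub>R One)) (real (Suc k) *\<^sub>R One) :: 'a set)"
    by (intro subset_box_imp) auto
  then show "indicator (cbox (- (real k *\<^sub>R One)) (real k *\<^sub>R One)) y \<le>
      (indicator (cbox (- (real (Suc k) *\<^sub>R One)) (real (Suc k) *\<^sub>R One)) y :: ennreal)"
    by (auto simp: indicator_def)
qed simp

text \<open>
  The boxes \<open>B k\<close> exhaust the space, so that monotone convergence, in \<open>y\<close> and then in \<open>\<tau>\<close>, turns the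
  truncated inequalities into the full one.
\<close>

lemma duhamel_inequality:
  fixes J :: "'a::euclidean_space \<Rightarrow> real" and \<psi> :: "'a \<Rightarrow> real \<Rightarrow> real"
  assumes J: "\<And>y. J y \<ge> 0" "continuous_on UNIV J"
    and cont: "continuous_on (UNIV \<times> {0..}) (\<lambda>(x, t). \<psi> x t)"
    and nonneg: "\<And>x t. t \<ge> 0 \<Longrightarrow> \<psi> x t \<ge> 0"
    and super: "time_deriv_ge J \<psi>"
    and "t \<ge> 0"
  shows "ennreal (\<psi> x 0) + (\<integral>\<^sup>+\<tau>. kconv J (\<lambda>y. ennreal (exp \<tau> * \<psi> y \<tau>)) x * indicator {0..t} \<tau> \<partial>lborel)
    \<le> ennreal (exp t * \<psi> x t)"
proof -
  define \<Psi> where "\<Psi> = (\<lambda>x t. \<psi> x (max 0 t))"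
  have cont_\<Psi>: "continuous_on UNIV (\<lambda>z. \<Psi> (fst z) (snd z))"
  proof -
    have "continuous_on UNIV (\<lambda>z::'a \<times> real. case (fst z, max 0 (snd z)) of (x, t) \<Rightarrow> \<psi> x t)"
      by (rule continuous_on_compose2[OF cont]) (auto intro!: continuous_intros)
    then show ?thesis by (simp add: \<Psi>_def)
  qed
  have cont_\<psi>: "continuous_on UNIV (\<lambda>y. \<psi> y \<tau>)" if "\<tau> \<ge> 0" for \<tau>
  proof -
    have "continuous_on UNIV (\<lambda>y. case (y, \<tau>) of (x, t) \<Rightarrow> \<psi> x t)"
      by (rule continuous_on_compose2[OF cont]) (use that in \<open>auto intro!: continuous_intros\<close>)
    then show ?thesis by simp
  qed
  have [measurable]: "J \<in> borel_measurable borel" by (rule borel_measurable_continuous_onI[OF J(2)])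
  have "continuous_on UNIV (\<lambda>p. \<Psi> (fst (snd p, fst p)) (snd (snd p, fst p)))"
    by (rule continuous_on_compose2[OF cont_\<Psi>]) (auto intro!: continuous_intros)
  then have [measurable]: "(\<lambda>p. \<Psi> (snd p) (fst p)) \<in> borel_measurable (borel \<Otimes>\<^sub>M borel)"
    by (simp add: borel_prod borel_measurable_continuous_onI)
  define B :: "nat \<Rightarrow> 'a set" where "B = (\<lambda>k. cbox (- (real k *\<^sub>R One)) (real k *\<^sub>R One))"
  have [measurable]: "B k \<in> sets borel" for k by (simp add: B_def)
  define F where "F = (\<lambda>k \<tau>. (\<integral>\<^sup>+y. ennreal (J (x - y) * (exp \<tau> * \<Psi> y \<tau>)) * indicator (B k) y \<partial>lborel) *
    indicator {0..t} \<tau>)"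
  have meas_pair: "(\<lambda>(\<tau>, y). ennreal (J (x - y) * (exp \<tau> * \<Psi> y \<tau>)) * indicator (B k) y) \<in>
      borel_measurable (borel \<Otimes>\<^sub>M borel)" for k
    by measurable
  have [measurable]: "F k \<in> borel_measurable lborel" for k
    unfolding F_def by measurable
  have F_int: "ennreal (\<psi> x 0) + (\<integral>\<^sup>+\<tau>. F k \<tau> \<partial>lborel) \<le> ennreal (exp t * \<psi> x t)" for k
  proof -
    let ?G = "\<lambda>\<tau>. exp \<tau> * integral (B k) (\<lambda>y. J (x - y) * \<psi> y \<tau>)"
    have B_k: "B k = cbox (- (real k *\<^sub>R One)) (real k *\<^sub>R One)" by (simp add: B_def)
    have duhamel: "?G integrable_on {0..t}" "\<psi> x 0 + integral {0..t} ?G \<le> exp t * \<psi> x t"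
      unfolding B_k using truncated_duhamel_inequality[OF J cont _ super \<open>t \<ge> 0\<close>] nonneg by blast+
    have G_nonneg: "?G \<tau> \<ge> 0" if "\<tau> \<ge> 0" for \<tau>
      using J(1) nonneg[OF that]
      by (cases "(\<lambda>y. J (x - y) * \<psi> y \<tau>) integrable_on B k")
        (auto intro!: mult_nonneg_nonneg Henstock_Kurzweil_Integration.integral_nonneg
          simp: not_integrable_integral)
    have "F k \<tau> = ennreal (?G \<tau>) * indicator {0..t} \<tau>" for \<tau>
    proof (cases "\<tau> \<in> {0..t}")
      case True
      then have "(\<integral>\<^sup>+y. ennreal (J (x - y) * (exp \<tau> * \<Psi> y \<tau>)) * indicator (B k) y \<partial>lborel) =
          (\<integral>\<^sup>+y. ennreal (exp \<tau>) * (ennreal (J (x - y) * \<psi> y \<tau>) * indicator (B k) y) \<partial>lborel)"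
        by (intro nn_integral_cong) (auto simp: \<Psi>_def ennreal_mult' J nonneg algebra_simps)
      also have "\<dots> = ennreal (exp \<tau>) * (\<integral>\<^sup>+y. ennreal (J (x - y) * \<psi> y \<tau>) * indicator (B k) y \<partial>lborel)"
      proof -
        have [measurable]: "(\<lambda>y. \<psi> y \<tau>) \<in> borel_measurable borel"
          using cont_\<psi>[of \<tau>] True by (intro borel_measurable_continuous_onI) simp
        show ?thesis by (rule nn_integral_cmult) measurable
      qed
      also have "\<dots> = ennreal (?G \<tau>)"
        using True J nonneg cont_\<psi>[of \<tau>] unfolding B_def
        by (subst kconv_indicator_cbox) (auto simp: ennreal_mult')
      finally show ?thesis by (simp add: F_def)
    qed (simp add: F_def)
    then have "(\<integral>\<^sup>+\<tau>. F k \<tau> \<partial>lborel) = ennreal (integral {0..t} ?G)"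
      using nn_integral_has_integral_lebesgue'[OF _ integrable_integral[OF duhamel(1)]] G_nonneg by simp
    also have "ennreal (\<psi> x 0) + ennreal (integral {0..t} ?G) = ennreal (\<psi> x 0 + integral {0..t} ?G)"
      using nonneg G_nonneg
      by (intro ennreal_plus[symmetric] Henstock_Kurzweil_Integration.integral_nonneg duhamel) auto
    also have "\<dots> \<le> ennreal (exp t * \<psi> x t)" using duhamel(2) by (rule ennreal_leI)
    finally show ?thesis .
  qed
  have "kconv J (\<lambda>y. ennreal (exp \<tau> * \<psi> y \<tau>)) x * indicator {0..t} \<tau> = (SUP k. F k \<tau>)" for \<tau>
  proof (cases "\<tau> \<in> {0..t}")
    case True
    have "kconv J (\<lambda>y. ennreal (exp \<tau> * \<psi> y \<tau>)) x =
        (\<integral>\<^sup>+y. (SUP k. ennreal (J (x - y) * (exp \<tau> * \<Psi> y \<tau>)) * indicator (B k) y) \<partial>lborel)"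
      unfolding kconv_def B_def SUP_indicator_cbox
      using True by (intro nn_integral_cong) (auto simp: \<Psi>_def ennreal_mult' J)
    also have "\<dots> = (SUP k. \<integral>\<^sup>+y. ennreal (J (x - y) * (exp \<tau> * \<Psi> y \<tau>)) * indicator (B k) y \<partial>lborel)"
    proof (rule nn_integral_monotone_convergence_SUP)
      show "incseq (\<lambda>k y. ennreal (J (x - y) * (exp \<tau> * \<Psi> y \<tau>)) * indicator (B k) y)"
        unfolding B_def by (rule incseq_indicator_cbox)
      show "(\<lambda>y. ennreal (J (x - y) * (exp \<tau> * \<Psi> y \<tau>)) * indicator (B k) y) \<in> borel_measurable lborel" for k
        using measurable_compose[OF measurable_Pair1' meas_pair, of \<tau> k]
        by (simp add: measurable_lborel2 cong: measurable_cong_sets)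
    qed
    finally show ?thesis using True by (simp add: F_def)
  qed (simp add: F_def)
  then have "(\<integral>\<^sup>+\<tau>. kconv J (\<lambda>y. ennreal (exp \<tau> * \<psi> y \<tau>)) x * indicator {0..t} \<tau> \<partial>lborel) =
      (\<integral>\<^sup>+\<tau>. (SUP k. F k \<tau>) \<partial>lborel)" by simp
  also have "\<dots> = (SUP k. \<integral>\<^sup>+\<tau>. F k \<tau> \<partial>lborel)"
  proof (rule nn_integral_monotone_convergence_SUP)
    show "incseq F"
      unfolding F_def B_def
      using incseq_indicator_cbox[where f = "\<lambda>y. ennreal (J (x - y) * (exp \<tau> * \<Psi> y \<tau>))" for \<tau>]
      by (auto simp: incseq_def le_fun_def intro!: mult_right_mono nn_integral_mono)
  qed simp
  finally have "ennreal (\<psi> x 0) + (\<integral>\<^sup>+\<tau>. kconv J (\<lambda>y. ennreal (exp \<tau> * \<psi> y \<tau>)) x * indicator {0..t} \<tau> \<partial>lborel) =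
      (SUP k. ennreal (\<psi> x 0) + (\<integral>\<^sup>+\<tau>. F k \<tau> \<partial>lborel))"
    by (simp add: ennreal_SUP_add_right)
  also have "\<dots> \<le> ennreal (exp t * \<psi> x t)" by (intro SUP_least F_int)
  finally show ?thesis .
qed

lemma nn_integral_power_over_fact:
  assumes "t \<ge> 0"
  shows "(\<integral>\<^sup>+\<tau>. ennreal (\<tau> ^ k / fact k) * indicator {0..t} \<tau> \<partial>lborel) = ennreal (t ^ Suc k / fact (Suc k))"
proof (rule nn_integral_has_integral_lebesgue')
  have "((\<lambda>\<tau>. \<tau> ^ Suc k / fact (Suc k)) has_real_derivative \<tau> ^ k / fact k) (at \<tau>)" for \<tau> :: real
    using DERIV_cdivide[OF DERIV_pow[of "Suc k" \<tau>], of "fact (Suc k)"]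
    by (simp del: of_nat_Suc)
  then have "((\<lambda>\<tau>. \<tau> ^ k / fact k) has_integral t ^ Suc k / fact (Suc k) - 0 ^ Suc k / fact (Suc k)) {0..t}"
    using assms by (intro fundamental_theorem_of_calculus)
      (auto simp: has_real_derivative_iff_has_vector_derivative[symmetric] intro: has_field_derivative_at_within)
  then show "((\<lambda>\<tau>. \<tau> ^ k / fact k) has_integral t ^ Suc k / fact (Suc k)) {0..t}" by simp
qed simp

text \<open>
  Each insertion of the inequality into itself adds one term to the sum, since integrating
  \<open>\<tau>\<^sup>k / k!\<close> over \<open>{0..t}\<close> gives \<open>t\<^sup>k\<^sup>+\<^sup>1 / (k+1)!\<close>.
\<close>

lemma picard_bound:
  fixes J :: "'a::euclidean_space \<Rightarrow> real" and \<psi> :: "'a \<Rightarrow> real \<Rightarrow> real"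
  assumes J: "\<And>y. J y \<ge> 0" "continuous_on UNIV J"
    and cont: "continuous_on (UNIV \<times> {0..}) (\<lambda>(x, t). \<psi> x t)"
    and nonneg: "\<And>x t. t \<ge> 0 \<Longrightarrow> \<psi> x t \<ge> 0"
    and super: "time_deriv_ge J \<psi>"
    and "t \<ge> 0"
  shows "(\<Sum>k\<le>n. ennreal (t ^ k / fact k) * (kconv J ^^ k) (\<lambda>y. ennreal (\<psi> y 0)) x) \<le> ennreal (exp t * \<psi> x t)"
  using \<open>t \<ge> 0\<close>
proof (induction n arbitrary: x t)
  case 0
  have "ennreal (\<psi> x 0) \<le> ennreal (exp t * \<psi> x t)"
    by (rule order_trans[OF _ duhamel_inequality[OF J cont nonneg super 0]]) simp_all
  then show ?case by simp
next
  case (Suc n)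
  let ?a = "\<lambda>k. (kconv J ^^ k) (\<lambda>y. ennreal (\<psi> y 0))"
  have [measurable]: "J \<in> borel_measurable borel" by (rule borel_measurable_continuous_onI[OF J(2)])
  have "continuous_on UNIV (\<lambda>y. case (y, 0) of (x, t) \<Rightarrow> \<psi> x t)"
    by (rule continuous_on_compose2[OF cont]) (auto intro!: continuous_intros)
  then have [measurable]: "(\<lambda>y. \<psi> y 0) \<in> borel_measurable borel"
    by (auto intro: borel_measurable_continuous_onI)
  have sum_kconv: "(\<Sum>k\<le>n. ennreal (\<tau> ^ k / fact k) * ?a (Suc k) x) =
      kconv J (\<lambda>y. \<Sum>k\<le>n. ennreal (\<tau> ^ k / fact k) * ?a k y) x" for \<tau>
  proof -
    have "kconv J (\<lambda>y. \<Sum>k\<le>n. ennreal (\<tau> ^ k / fact k) * ?a k y) x =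
        (\<integral>\<^sup>+y. (\<Sum>k\<le>n. ennreal (\<tau> ^ k / fact k) * (ennreal (J (x - y)) * ?a k y)) \<partial>lborel)"
      unfolding kconv_def by (intro nn_integral_cong) (simp add: sum_distrib_left mult.left_commute)
    also have "\<dots> = (\<Sum>k\<le>n. ennreal (\<tau> ^ k / fact k) * kconv J (?a k) x)"
      by (subst nn_integral_sum) (simp_all add: nn_integral_cmult kconv_def[symmetric])
    finally show ?thesis by simp
  qed
  have "(\<Sum>k\<le>Suc n. ennreal (t ^ k / fact k) * ?a k x) =
      ennreal (\<psi> x 0) + (\<Sum>k\<le>n. ennreal (t ^ Suc k / fact (Suc k)) * ?a (Suc k) x)"
    by (subst sum.atMost_Suc_shift) simp
  also have "(\<Sum>k\<le>n. ennreal (t ^ Suc k / fact (Suc k)) * ?a (Suc k) x) =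
      (\<Sum>k\<le>n. \<integral>\<^sup>+\<tau>. (ennreal (\<tau> ^ k / fact k) * indicator {0..t} \<tau>) * ?a (Suc k) x \<partial>lborel)"
    by (subst nn_integral_multc) (simp_all only: nn_integral_power_over_fact[OF Suc.prems], simp_all)
  also have "\<dots> = (\<integral>\<^sup>+\<tau>. (\<Sum>k\<le>n. (ennreal (\<tau> ^ k / fact k) * indicator {0..t} \<tau>) * ?a (Suc k) x) \<partial>lborel)"
    by (rule nn_integral_sum[symmetric]) simp
  also have "\<dots> \<le> (\<integral>\<^sup>+\<tau>. kconv J (\<lambda>y. ennreal (exp \<tau> * \<psi> y \<tau>)) x * indicator {0..t} \<tau> \<partial>lborel)"
  proof (rule nn_integral_mono)
    fix \<tau>
    show "(\<Sum>k\<le>n. (ennreal (\<tau> ^ k / fact k) * indicator {0..t} \<tau>) * ?a (Suc k) x) \<le>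
        kconv J (\<lambda>y. ennreal (exp \<tau> * \<psi> y \<tau>)) x * indicator {0..t} \<tau>"
    proof (cases "\<tau> \<in> {0..t}")
      case True
      then have "(\<Sum>k\<le>n. ennreal (\<tau> ^ k / fact k) * ?a k y) \<le> ennreal (exp \<tau> * \<psi> y \<tau>)" for y
        by (intro Suc.IH) simp
      from kconv_mono[OF this] show ?thesis using True sum_kconv[of \<tau>] by simp
    qed simp
  qed
  finally show ?case
    using duhamel_inequality[OF J cont nonneg super Suc.prems, of x]
    by (meson add_left_mono order_trans)
qed

section \<open>Convolution powers of the kernel\<close>

lemma integral_enn2real:
  assumes [measurable]: "f \<in> borel_measurable M" and fin: "(\<integral>\<^sup>+y. f y \<partial>M) < \<infinity>"
  shows "integrable M (\<lambda>y. enn2real (f y))" "(\<integral>y. enn2real (f y) \<partial>M) = enn2real (\<integral>\<^sup>+y. f y \<partial>M)"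
proof -
  have "AE y in M. f y \<noteq> \<infinity>" using fin by (intro nn_integral_PInf_AE) auto
  then have *: "(\<integral>\<^sup>+y. ennreal (enn2real (f y)) \<partial>M) = (\<integral>\<^sup>+y. f y \<partial>M)"
    by (intro nn_integral_cong_AE) (auto elim!: eventually_mono simp: top.not_eq_extremum)
  show "integrable M (\<lambda>y. enn2real (f y))"
    using fin by (intro integrableI_bounded) (auto simp: *)
  show "(\<integral>y. enn2real (f y) \<partial>M) = enn2real (\<integral>\<^sup>+y. f y \<partial>M)"
    by (subst integral_eq_nn_integral) (auto simp: *)
qed

lemma kernel_borel_measurable:
  "convolution_kernel J \<Longrightarrow> J \<in> borel_measurable borel"
  unfolding convolution_kernel_def by (intro borel_measurable_continuous_onI) blast

lemma kernel_nn_integral: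
  assumes "convolution_kernel J"
  shows "(\<integral>\<^sup>+y. ennreal (J y) \<partial>lborel) = 1"
proof -
  have "has_bochner_integral lebesgue J 1" "\<And>y. J y \<ge> 0"
    using assms unfolding convolution_kernel_def by auto
  then have "(\<integral>\<^sup>+y. ennreal (J y) \<partial>lebesgue) = 1"
    by (subst nn_integral_eq_integral) (auto simp: has_bochner_integral_iff)
  then show ?thesis by (simp add: nn_integral_completion)
qed

abbreviation kernel_power :: "('a::euclidean_space \<Rightarrow> real) \<Rightarrow> nat \<Rightarrow> 'a \<Rightarrow> ennreal" where
  "kernel_power J n \<equiv> (kconv J ^^ n) (\<lambda>z. ennreal (J z))"

text \<open>
  Associativity of convolution. The index \<open>n\<close> on the left-hand side counts \<open>n + 1\<close> copies of \<open>J\<close>.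
\<close>

lemma kernel_power_conv:
  fixes J :: "'a::euclidean_space \<Rightarrow> real"
  assumes [measurable]: "J \<in> borel_measurable borel" "f \<in> borel_measurable borel"
  shows "(\<integral>\<^sup>+y. kernel_power J n (x - y) * f y \<partial>lborel) = (kconv J ^^ Suc n) f x"
proof (induction n arbitrary: x)
  case 0
  then show ?case by (simp add: kconv_def)
next
  case (Suc n)
  have "(\<integral>\<^sup>+y. kernel_power J (Suc n) (x - y) * f y \<partial>lborel) =
      (\<integral>\<^sup>+y. \<integral>\<^sup>+w. ennreal (J (x - w)) * (kernel_power J n (w - y) * f y) \<partial>lborel \<partial>lborel)"
  proof (rule nn_integral_cong)
    fix y
    have "kernel_power J (Suc n) (x - y) = (\<integral>\<^sup>+z. ennreal (J (x - y - z)) * kernel_power J n z \<partial>lborel)"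
      by (simp add: kconv_def)
    also have "\<dots> = (\<integral>\<^sup>+w. ennreal (J (x - y - (w - y))) * kernel_power J n (w - y) \<partial>lborel)"
      by (rule nn_integral_lborel_translate[symmetric]) measurable
    also have "\<dots> = (\<integral>\<^sup>+w. ennreal (J (x - w)) * kernel_power J n (w - y) \<partial>lborel)" by simp
    finally show "kernel_power J (Suc n) (x - y) * f y =
        (\<integral>\<^sup>+w. ennreal (J (x - w)) * (kernel_power J n (w - y) * f y) \<partial>lborel)"
      by (simp add: nn_integral_multc[symmetric] mult.assoc)
  qed
  also have "\<dots> = (\<integral>\<^sup>+w. \<integral>\<^sup>+y. ennreal (J (x - w)) * (kernel_power J n (w - y) * f y) \<partial>lborel \<partial>lborel)"
    by (rule lborel_pair.Fubini') measurable
  also have "\<dots> = (\<integral>\<^sup>+w. ennreal (J (x - w)) * (kconv J ^^ Suc n) f w \<partial>lborel)"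
    by (subst nn_integral_cmult) (simp_all only: Suc.IH, measurable)
  also have "\<dots> = (kconv J ^^ Suc (Suc n)) f x" by (simp add: kconv_def[of J "kconv J _"])
  finally show ?case .
qed

lemma kconv_power_one:
  assumes "convolution_kernel J"
  shows "(kconv J ^^ n) (\<lambda>_. 1) = (\<lambda>_. 1)"
proof (induction n)
  case (Suc n)
  note [measurable] = kernel_borel_measurable[OF assms]
  have "kconv J (\<lambda>_. 1) x = 1" for x
    using nn_integral_lborel_affine_reflect[of "\<lambda>y. ennreal (J y)" x] kernel_nn_integral[OF assms]
    by (simp add: kconv_def)
  then show ?case using Suc by auto
qed simp

text \<open>
  The powers of \<open>J\<close> are probability densities. They may be infinite at some points, but only on
  null sets, where \<open>conv_power\<close> then has the value \<open>0\<close>.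
\<close>

lemma kernel_power_mass:
  assumes "convolution_kernel J"
  shows "(\<integral>\<^sup>+y. kernel_power J n (x - y) \<partial>lborel) = 1"
  using kernel_power_conv[of J "\<lambda>_. 1" n x] kernel_borel_measurable[OF assms] kconv_power_one[OF assms, of "Suc n"]
  by simp

lemma kernel_power_finite_AE:
  assumes "convolution_kernel J"
  shows "AE y in lborel. kernel_power J n y < \<infinity>" "AE y in lborel. kernel_power J n (x - y) < \<infinity>"
proof -
  note [measurable] = kernel_borel_measurable[OF assms]
  have "AE y in lborel. kernel_power J n (x - y) \<noteq> \<infinity>"
    by (rule nn_integral_PInf_AE) (simp_all add: kernel_power_mass[OF assms])
  then show "AE y in lborel. kernel_power J n (x - y) < \<infinity>" by (simp add: top.not_eq_extremum)
  have "(\<integral>\<^sup>+y. kernel_power J n y \<partial>lborel) = 1"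
    using nn_integral_lborel_affine_reflect[of "kernel_power J n" 0] kernel_power_mass[OF assms, of n 0] by simp
  then have "AE y in lborel. kernel_power J n y \<noteq> \<infinity>"
    by (intro nn_integral_PInf_AE) simp_all
  then show "AE y in lborel. kernel_power J n y < \<infinity>" by (simp add: top.not_eq_extremum)
qed

lemma conv_power_eq:
  fixes J :: "'a::euclidean_space \<Rightarrow> real"
  assumes "convolution_kernel J"
  shows "conv_power J (Suc n) = (\<lambda>x. enn2real (kernel_power J n x))"
proof -
  note [measurable] = kernel_borel_measurable[OF assms]
  have nonneg: "J y \<ge> 0" for y using assms unfolding convolution_kernel_def by auto
  have "(conv J ^^ n) J = (\<lambda>x. enn2real (kernel_power J n x))"
  proof (induction n)
    case (Suc n)
    have "conv J ((conv J ^^ n) J) x = enn2real (kernel_power J (Suc n) x)" for x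
    proof -
      have "conv J ((conv J ^^ n) J) x = (\<integral>y. J (x - y) * enn2real (kernel_power J n y) \<partial>lborel)"
        unfolding Suc.IH conv_def by (rule integral_lebesgue_borel) measurable
      also have "\<dots> = enn2real (\<integral>\<^sup>+y. ennreal (J (x - y) * enn2real (kernel_power J n y)) \<partial>lborel)"
        by (intro integral_eq_nn_integral) (auto simp: nonneg)
      also have "(\<integral>\<^sup>+y. ennreal (J (x - y) * enn2real (kernel_power J n y)) \<partial>lborel) =
          (\<integral>\<^sup>+y. ennreal (J (x - y)) * kernel_power J n y \<partial>lborel)"
        using kernel_power_finite_AE(1)[OF assms, of n]
        by (intro nn_integral_cong_AE) (auto elim!: eventually_mono simp: ennreal_mult' nonneg)
      finally show ?thesis by (simp add: kconv_def)
    qed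
    then show ?case by auto
  qed (simp add: nonneg)
  then show ?thesis by (simp add: conv_power_def)
qed

text \<open>
  This is \<open>J\<^sup>*\<^sup>n * B\<close> for a signed function \<open>B\<close>: as \<open>ennreal\<close> sends negative numbers to \<open>0\<close>, the two
  terms come from the positive and from the negative part of \<open>B\<close>.
\<close>

definition signed_iterate :: "('a::euclidean_space \<Rightarrow> real) \<Rightarrow> ('a \<Rightarrow> real) \<Rightarrow> nat \<Rightarrow> 'a \<Rightarrow> real" where
  "signed_iterate J B n x =
     enn2real ((kconv J ^^ n) (\<lambda>y. ennreal (B y)) x) - enn2real ((kconv J ^^ n) (\<lambda>y. ennreal (- B y)) x)"

context
  fixes J B f :: "'a::euclidean_space \<Rightarrow> real"
  assumes kernel: "convolution_kernel J"
    and B_borel [measurable]: "B \<in> borel_measurable borel"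
    and B_le: "\<And>x. \<bar>B x\<bar> \<le> f x"
    and finite: "\<And>n x. (kconv J ^^ n) (\<lambda>y. ennreal (f y)) x < \<infinity>"
begin

lemma pos_neg_iterate_le:
  "(kconv J ^^ n) (\<lambda>y. ennreal (B y)) x \<le> (kconv J ^^ n) (\<lambda>y. ennreal (f y)) x"
  "(kconv J ^^ n) (\<lambda>y. ennreal (- B y)) x \<le> (kconv J ^^ n) (\<lambda>y. ennreal (f y)) x"
  using B_le by (intro kconv_power_mono ennreal_leI; simp add: abs_le_iff)+

lemma pos_neg_iterate_finite:
  "(kconv J ^^ n) (\<lambda>y. ennreal (B y)) x < \<infinity>"
  "(kconv J ^^ n) (\<lambda>y. ennreal (- B y)) x < \<infinity>"
  using pos_neg_iterate_le finite le_less_trans by blast+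

lemma signed_iterate_0: "signed_iterate J B 0 x = B x"
  by (cases "B x \<ge> 0") (simp_all add: signed_iterate_def ennreal_neg)

lemma signed_iterate_abs_le: "\<bar>signed_iterate J B n x\<bar> \<le> enn2real ((kconv J ^^ n) (\<lambda>y. ennreal (f y)) x)"
proof -
  have "enn2real ((kconv J ^^ n) (\<lambda>y. ennreal (B y)) x) \<le> enn2real ((kconv J ^^ n) (\<lambda>y. ennreal (f y)) x)"
    "enn2real ((kconv J ^^ n) (\<lambda>y. ennreal (- B y)) x) \<le> enn2real ((kconv J ^^ n) (\<lambda>y. ennreal (f y)) x)"
    using pos_neg_iterate_le finite by (auto intro!: enn2real_mono)
  moreover have "enn2real ((kconv J ^^ n) (\<lambda>y. ennreal (B y)) x) \<ge> 0"
    "enn2real ((kconv J ^^ n) (\<lambda>y. ennreal (- B y)) x) \<ge> 0" by simp_all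
  ultimately show ?thesis unfolding signed_iterate_def by linarith
qed

lemma signed_iterate_measurable [measurable]: "signed_iterate J B n \<in> borel_measurable borel"
proof -
  note [measurable] = kernel_borel_measurable[OF kernel]
  show ?thesis unfolding signed_iterate_def by measurable
qed

lemma conv_signed_iterate:
  "integrable lborel (\<lambda>y. J (x - y) * signed_iterate J B n y)"
  "(\<integral>y. J (x - y) * signed_iterate J B n y \<partial>lborel) = signed_iterate J B (Suc n) x"
proof -
  note [measurable] = kernel_borel_measurable[OF kernel]
  have nonneg: "J y \<ge> 0" for y using kernel unfolding convolution_kernel_def by auto
  let ?p = "\<lambda>y. ennreal (J (x - y)) * (kconv J ^^ n) (\<lambda>y. ennreal (B y)) y"
  let ?m = "\<lambda>y. ennreal (J (x - y)) * (kconv J ^^ n) (\<lambda>y. ennreal (- B y)) y"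
  have p: "(\<integral>\<^sup>+y. ?p y \<partial>lborel) = (kconv J ^^ Suc n) (\<lambda>y. ennreal (B y)) x"
    and m: "(\<integral>\<^sup>+y. ?m y \<partial>lborel) = (kconv J ^^ Suc n) (\<lambda>y. ennreal (- B y)) x"
    by (simp_all add: kconv_def[of J "(kconv J ^^ n) _"])
  have eq: "J (x - y) * signed_iterate J B n y = enn2real (?p y) - enn2real (?m y)" for y
    using nonneg by (simp add: signed_iterate_def enn2real_mult algebra_simps)
  have ip: "integrable lborel (\<lambda>y. enn2real (?p y))" "(\<integral>y. enn2real (?p y) \<partial>lborel) = enn2real ((kconv J ^^ Suc n) (\<lambda>y. ennreal (B y)) x)"
    using integral_enn2real[of ?p lborel] pos_neg_iterate_finite(1)[of "Suc n" x] unfolding p by simp_all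
  have im: "integrable lborel (\<lambda>y. enn2real (?m y))" "(\<integral>y. enn2real (?m y) \<partial>lborel) = enn2real ((kconv J ^^ Suc n) (\<lambda>y. ennreal (- B y)) x)"
    using integral_enn2real[of ?m lborel] pos_neg_iterate_finite(2)[of "Suc n" x] unfolding m by simp_all
  show "integrable lborel (\<lambda>y. J (x - y) * signed_iterate J B n y)"
    unfolding eq by (rule Bochner_Integration.integrable_diff[OF ip(1) im(1)])
  show "(\<integral>y. J (x - y) * signed_iterate J B n y \<partial>lborel) = signed_iterate J B (Suc n) x"
    by (simp only: eq Bochner_Integration.integral_diff[OF ip(1) im(1)] ip(2) im(2) signed_iterate_def[of J B "Suc n" x])
qed

lemma conv_power_signed_iterate:
  "integrable lborel (\<lambda>y. conv_power J (Suc n) (x - y) * B y)"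
  "(\<integral>y. conv_power J (Suc n) (x - y) * B y \<partial>lborel) = signed_iterate J B (Suc n) x"
proof -
  note [measurable] = kernel_borel_measurable[OF kernel]
  let ?p = "\<lambda>y. kernel_power J n (x - y) * ennreal (B y)"
  let ?m = "\<lambda>y. kernel_power J n (x - y) * ennreal (- B y)"
  have p: "(\<integral>\<^sup>+y. ?p y \<partial>lborel) = (kconv J ^^ Suc n) (\<lambda>y. ennreal (B y)) x"
    and m: "(\<integral>\<^sup>+y. ?m y \<partial>lborel) = (kconv J ^^ Suc n) (\<lambda>y. ennreal (- B y)) x"
    by (intro kernel_power_conv; simp)+
  have eq: "conv_power J (Suc n) (x - y) * B y = enn2real (?p y) - enn2real (?m y)" for y
    unfolding conv_power_eq[OF kernel]
    by (cases "B y \<ge> 0") (simp_all add: enn2real_mult ennreal_neg)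
  have ip: "integrable lborel (\<lambda>y. enn2real (?p y))" "(\<integral>y. enn2real (?p y) \<partial>lborel) = enn2real ((kconv J ^^ Suc n) (\<lambda>y. ennreal (B y)) x)"
    using integral_enn2real[of ?p lborel] pos_neg_iterate_finite(1)[of "Suc n" x] unfolding p by simp_all
  have im: "integrable lborel (\<lambda>y. enn2real (?m y))" "(\<integral>y. enn2real (?m y) \<partial>lborel) = enn2real ((kconv J ^^ Suc n) (\<lambda>y. ennreal (- B y)) x)"
    using integral_enn2real[of ?m lborel] pos_neg_iterate_finite(2)[of "Suc n" x] unfolding m by simp_all
  show "integrable lborel (\<lambda>y. conv_power J (Suc n) (x - y) * B y)"
    unfolding eq by (rule Bochner_Integration.integrable_diff[OF ip(1) im(1)])
  show "(\<integral>y. conv_power J (Suc n) (x - y) * B y \<partial>lborel) = signed_iterate J B (Suc n) x"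
    by (simp only: eq Bochner_Integration.integral_diff[OF ip(1) im(1)] ip(2) im(2) signed_iterate_def[of J B "Suc n" x])
qed

lemma conv_abs_signed_iterate_le:
  "(\<integral>y. J (x - y) * \<bar>signed_iterate J B n y\<bar> \<partial>lborel) \<le> enn2real ((kconv J ^^ Suc n) (\<lambda>y. ennreal (f y)) x)"
proof (rule integral_real_bounded)
  have nonneg: "J y \<ge> 0" for y using kernel unfolding convolution_kernel_def by auto
  have "ennreal \<bar>signed_iterate J B n y\<bar> \<le> (kconv J ^^ n) (\<lambda>y. ennreal (f y)) y" for y
  proof -
    have "ennreal (enn2real ((kconv J ^^ n) (\<lambda>y. ennreal (f y)) y)) = (kconv J ^^ n) (\<lambda>y. ennreal (f y)) y"
      using finite[of n y] by simp
    then show ?thesis using ennreal_leI[OF signed_iterate_abs_le[of n y]] by (simp only:)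
  qed
  then have "(\<integral>\<^sup>+y. ennreal (J (x - y) * \<bar>signed_iterate J B n y\<bar>) \<partial>lborel) \<le> (kconv J ^^ Suc n) (\<lambda>y. ennreal (f y)) x"
    unfolding funpow.simps comp_apply kconv_def[of J "(kconv J ^^ n) _"]
    by (intro nn_integral_mono) (simp add: ennreal_mult' nonneg mult_left_mono)
  then show "(\<integral>\<^sup>+y. ennreal (J (x - y) * \<bar>signed_iterate J B n y\<bar>) \<partial>lborel)
      \<le> ennreal (enn2real ((kconv J ^^ Suc n) (\<lambda>y. ennreal (f y)) x))"
    using finite[of "Suc n" x] by (simp add: top.not_eq_extremum)
qed simp

lemma conv_power_abs_le:
  assumes [measurable]: "f \<in> borel_measurable borel"
  shows "(\<integral>y. conv_power J (Suc n) (x - y) * \<bar>B y\<bar> \<partial>lborel) \<le> enn2real ((kconv J ^^ Suc n) (\<lambda>y. ennreal (f y)) x)"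
proof (rule integral_real_bounded)
  note [measurable] = kernel_borel_measurable[OF kernel]
  have "(\<integral>\<^sup>+y. ennreal (conv_power J (Suc n) (x - y) * \<bar>B y\<bar>) \<partial>lborel) \<le>
      (\<integral>\<^sup>+y. kernel_power J n (x - y) * ennreal (f y) \<partial>lborel)"
  proof (rule nn_integral_mono)
    fix y
    have "ennreal (enn2real (kernel_power J n (x - y))) \<le> kernel_power J n (x - y)"
      by (cases "kernel_power J n (x - y)") auto
    then show "ennreal (conv_power J (Suc n) (x - y) * \<bar>B y\<bar>) \<le> kernel_power J n (x - y) * ennreal (f y)"
      unfolding conv_power_eq[OF kernel] using B_le[of y]
      by (simp add: ennreal_mult' mult_mono ennreal_leI)
  qed
  also have "\<dots> = (kconv J ^^ Suc n) (\<lambda>y. ennreal (f y)) x" by (rule kernel_power_conv) measurable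
  finally show "(\<integral>\<^sup>+y. ennreal (conv_power J (Suc n) (x - y) * \<bar>B y\<bar>) \<partial>lborel)
      \<le> ennreal (enn2real ((kconv J ^^ Suc n) (\<lambda>y. ennreal (f y)) x))"
    using finite[of "Suc n" x] by (simp add: top.not_eq_extremum)
qed simp

end

lemma conv_power_integral:
  assumes "convolution_kernel J"
  shows "integrable lborel (\<lambda>y. conv_power J (Suc n) (x - y))" "(\<integral>y. conv_power J (Suc n) (x - y) \<partial>lborel) = 1"
    "conv_power J (Suc n) y \<ge> 0"
proof -
  note [measurable] = kernel_borel_measurable[OF assms]
  show "integrable lborel (\<lambda>y. conv_power J (Suc n) (x - y))" "(\<integral>y. conv_power J (Suc n) (x - y) \<partial>lborel) = 1"
    "conv_power J (Suc n) y \<ge> 0"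
    unfolding conv_power_eq[OF assms]
    using integral_enn2real[of "\<lambda>y. kernel_power J n (x - y)" lborel] kernel_power_mass[OF assms, of n x] by simp_all
qed

text \<open>
  Summable \<open>L\<^sup>1\<close> norms imply absolute convergence almost everywhere, because the sum of the absolute
  values has a finite integral.
\<close>

lemma integral_suminf_absolute:
  fixes f :: "nat \<Rightarrow> 'b \<Rightarrow> real"
  assumes int: "\<And>n. integrable M (f n)" and sum: "summable (\<lambda>n. \<integral>x. \<bar>f n x\<bar> \<partial>M)"
  shows "AE x in M. summable (\<lambda>n. \<bar>f n x\<bar>)"
    and "integrable M (\<lambda>x. \<Sum>n. f n x)"
    and "(\<integral>x. (\<Sum>n. f n x) \<partial>M) = (\<Sum>n. \<integral>x. f n x \<partial>M)"
proof -
  note [measurable] = borel_measurable_integrable[OF int]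
  have "(\<integral>\<^sup>+x. (\<Sum>n. ennreal \<bar>f n x\<bar>) \<partial>M) = (\<Sum>n. \<integral>\<^sup>+x. ennreal \<bar>f n x\<bar> \<partial>M)"
    by (rule nn_integral_suminf) measurable
  also have "\<dots> = (\<Sum>n. ennreal (\<integral>x. \<bar>f n x\<bar> \<partial>M))"
    using int by (subst nn_integral_eq_integral) auto
  also have "\<dots> = ennreal (\<Sum>n. \<integral>x. \<bar>f n x\<bar> \<partial>M)"
    using sum by (intro suminf_ennreal2) auto
  finally have "(\<integral>\<^sup>+x. (\<Sum>n. ennreal \<bar>f n x\<bar>) \<partial>M) \<noteq> \<infinity>" by simp
  then have "AE x in M. (\<Sum>n. ennreal \<bar>f n x\<bar>) \<noteq> \<infinity>"
    by (intro nn_integral_PInf_AE) auto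
  then show ae: "AE x in M. summable (\<lambda>n. \<bar>f n x\<bar>)"
    by eventually_elim (auto intro: summable_suminf_not_top)
  show "integrable M (\<lambda>x. \<Sum>n. f n x)"
    using integrable_suminf[of M f, OF int] ae sum by simp
  show "(\<integral>x. (\<Sum>n. f n x) \<partial>M) = (\<Sum>n. \<integral>x. f n x \<partial>M)"
    using integral_suminf[of M f, OF int] ae sum by simp
qed

section \<open>Poisson means\<close>

text \<open>
  This is the mean of \<open>a\<close> under the Poisson distribution with parameter \<open>t\<close>.
\<close>

definition poisson_mean :: "(nat \<Rightarrow> real) \<Rightarrow> real \<Rightarrow> real" where
  "poisson_mean a t = exp (- t) * (\<Sum>n. a n / fact n * t ^ n)"

lemma diffs_over_fact: "diffs (\<lambda>n. a n / fact n) = (\<lambda>n. a (Suc n) / fact n :: real)"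
  by (simp add: diffs_def fun_eq_iff field_simps del: of_nat_Suc)

lemma summable_shift_over_fact:
  assumes "\<And>t::real. summable (\<lambda>n. a n / fact n * t ^ n)"
  shows "summable (\<lambda>n. a (Suc n) / fact n * t ^ n)"
  using termdiff_converges_all[OF assms, of t] unfolding diffs_over_fact .

text \<open>
  This is why the exponential series solves the equation: \<open>J * _\<close> acts on the sequence of iterates as
  the shift.
\<close>

lemma poisson_mean_derivative:
  assumes "\<And>t::real. summable (\<lambda>n. a n / fact n * t ^ n)"
  shows "(poisson_mean a has_real_derivative (poisson_mean (\<lambda>n. a (Suc n)) t - poisson_mean a t)) (at t)"
proof -
  have "((\<lambda>t. exp (- t)) has_real_derivative - exp (- t)) (at t)"
    by (auto intro!: derivative_eq_intros)
  from DERIV_mult[OF this termdiffs_strong_converges_everywhere[OF assms, of t]]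
  show ?thesis
    unfolding poisson_mean_def[abs_def] diffs_over_fact by (rule DERIV_cong) (simp add: algebra_simps)
qed

lemma Suc_mult_power_le:
  fixes t :: real
  assumes "t \<ge> 0"
  shows "real (Suc n) * t ^ n \<le> (t + 1) ^ Suc n"
proof (induction n)
  case (Suc n)
  have "t ^ Suc n \<le> (t + 1) ^ Suc n" using assms by (intro power_mono) auto
  moreover have "t * (real (Suc n) * t ^ n) \<le> t * (t + 1) ^ Suc n"
    using Suc assms by (intro mult_left_mono)
  ultimately show ?case by (simp add: algebra_simps)
qed (use assms in simp)

text \<open>
  The last bound costs one unit of time: the terms of the shifted series are
  \<open>(n + 1) t\<^sup>n * a\<^sub>n\<^sub>+\<^sub>1 / (n+1)!\<close>, and \<open>(n + 1) t\<^sup>n \<le> (t + 1)\<^sup>n\<^sup>+\<^sup>1\<close>.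
\<close>

lemma poisson_mean_bounds:
  fixes a \<alpha> :: "nat \<Rightarrow> real" and M :: "real \<Rightarrow> real"
  assumes a: "\<And>n. \<bar>a n\<bar> \<le> \<alpha> n"
    and M: "\<And>n t. t \<ge> 0 \<Longrightarrow> (\<Sum>k\<le>n. \<alpha> k / fact k * t ^ k) \<le> exp t * M t"
  shows "summable (\<lambda>n. \<alpha> n / fact n * t ^ n)"
    and "summable (\<lambda>n. a n / fact n * t ^ n)"
    and "t \<ge> 0 \<Longrightarrow> \<bar>poisson_mean a t\<bar> \<le> M t"
    and "t \<ge> 0 \<Longrightarrow> \<bar>poisson_mean (\<lambda>n. a (Suc n)) t\<bar> \<le> exp 1 * M (t + 1)"
proof -
  have \<alpha>: "\<alpha> n \<ge> 0" for n using a[of n] by linarith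
  have sum_nonneg: "summable (\<lambda>n. \<alpha> n / fact n * t ^ n)" if "t \<ge> 0" for t
  proof (rule bounded_imp_summable)
    show "\<alpha> n / fact n * t ^ n \<ge> 0" for n using \<alpha> that by simp
    show "(\<Sum>k\<le>n. \<alpha> k / fact k * t ^ k) \<le> exp t * M t" for n using M that by blast
  qed
  have abs_sum: "summable (\<lambda>n. \<bar>\<alpha> n / fact n * t ^ n\<bar>)" for t
    using sum_nonneg[of "\<bar>t\<bar>"] \<alpha> by (simp add: abs_mult power_abs)
  then show "summable (\<lambda>n. \<alpha> n / fact n * t ^ n)" for t by (rule summable_rabs_cancel)
  have le: "\<bar>a n / fact n * t ^ n\<bar> \<le> \<bar>\<alpha> n / fact n * t ^ n\<bar>" for n t
    using a[of n] \<alpha>[of n] by (simp add: abs_mult divide_right_mono mult_right_mono)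
  show a_sum: "summable (\<lambda>n. a n / fact n * t ^ n)" for t
    by (rule summable_comparison_test'[OF abs_sum[of t], of 0]) (use le in auto)
  have \<alpha>_le: "(\<Sum>n. \<alpha> n / fact n * t ^ n) \<le> exp t * M t" if "t \<ge> 0" for t
    using M[OF that] sum_nonneg[OF that]
    by (intro LIMSEQ_le_const2[OF summable_LIMSEQ']) auto
  show "\<bar>poisson_mean a t\<bar> \<le> M t" if "t \<ge> 0" for t
  proof -
    have s': "summable (\<lambda>n. \<bar>a n / fact n * t ^ n\<bar>)"
      by (rule summable_comparison_test'[OF abs_sum[of t], of 0]) (use le in auto)
    have le': "\<bar>a n / fact n * t ^ n\<bar> \<le> \<alpha> n / fact n * t ^ n" for n
      using le[of n t] \<alpha>[of n] that by (simp add: abs_mult)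
    have "\<bar>\<Sum>n. a n / fact n * t ^ n\<bar> \<le> (\<Sum>n. \<bar>a n / fact n * t ^ n\<bar>)"
      by (rule summable_rabs[OF s'])
    also have "\<dots> \<le> (\<Sum>n. \<alpha> n / fact n * t ^ n)"
      by (rule suminf_le[OF le' s' sum_nonneg[OF that]])
    also have "\<dots> \<le> exp t * M t" by (rule \<alpha>_le[OF that])
    finally have "exp (- t) * \<bar>\<Sum>n. a n / fact n * t ^ n\<bar> \<le> exp (- t) * (exp t * M t)"
      by (intro mult_left_mono) auto
    then show ?thesis
      by (simp add: poisson_mean_def abs_mult exp_minus field_simps)
  qed
  show "\<bar>poisson_mean (\<lambda>n. a (Suc n)) t\<bar> \<le> exp 1 * M (t + 1)" if "t \<ge> 0" for t
  proof -
    have s: "summable (\<lambda>n. \<alpha> (Suc n) / fact (Suc n) * (t + 1) ^ Suc n)"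
      using sum_nonneg[of "t + 1"] that by (subst summable_Suc_iff) auto
    have term_le: "\<bar>a (Suc n) / fact n * t ^ n\<bar> \<le> \<alpha> (Suc n) / fact (Suc n) * (t + 1) ^ Suc n" for n
    proof -
      have "\<bar>a (Suc n) / fact n * t ^ n\<bar> = \<bar>a (Suc n)\<bar> / fact (Suc n) * (real (Suc n) * t ^ n)"
        using that by (simp add: abs_mult field_simps del: of_nat_Suc)
      also have "\<dots> \<le> \<alpha> (Suc n) / fact (Suc n) * (t + 1) ^ Suc n"
        using a \<alpha> that by (intro mult_mono divide_right_mono Suc_mult_power_le) auto
      finally show ?thesis .
    qed
    have s': "summable (\<lambda>n. \<bar>a (Suc n) / fact n * t ^ n\<bar>)"
      by (rule summable_comparison_test'[OF s, of 0]) (use term_le in auto)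
    have "\<bar>\<Sum>n. a (Suc n) / fact n * t ^ n\<bar> \<le> (\<Sum>n. \<bar>a (Suc n) / fact n * t ^ n\<bar>)"
      by (rule summable_rabs[OF s'])
    also have "\<dots> \<le> (\<Sum>n. \<alpha> (Suc n) / fact (Suc n) * (t + 1) ^ Suc n)"
      by (rule suminf_le[OF term_le s' s])
    also have "\<dots> \<le> (\<Sum>n. \<alpha> n / fact n * (t + 1) ^ n)"
      using suminf_split_head[OF sum_nonneg[of "t + 1"]] that \<alpha>[of 0] by simp
    also have "\<dots> \<le> exp (t + 1) * M (t + 1)" using that by (intro \<alpha>_le) simp
    finally have "exp (- t) * \<bar>\<Sum>n. a (Suc n) / fact n * t ^ n\<bar> \<le> exp (- t) * (exp (t + 1) * M (t + 1))"
      by (intro mult_left_mono) auto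
    then show ?thesis
      by (simp add: poisson_mean_def abs_mult exp_minus exp_add field_simps)
  qed
qed

section \<open>The solution\<close>

lemma AE_lebesgue_fst:
  fixes P :: "'a::euclidean_space \<Rightarrow> bool"
  assumes "AE x in lebesgue. P x"
  shows "AE z in (lebesgue :: ('a \<times> real) measure). P (fst z)"
proof -
  have "AE x in lborel. P x" using assms by (simp add: AE_completion_iff)
  then obtain N where N: "{x \<in> space lborel. \<not> P x} \<subseteq> N" "N \<in> null_sets lborel"
    by (metis AE_E null_setsI)
  have "AE z in (lborel \<Otimes>\<^sub>M (lborel :: real measure)). fst z \<notin> N"
  proof (rule lborel_pair.AE_pair_measure)
    show "{z \<in> space (lborel \<Otimes>\<^sub>M (lborel :: real measure)). fst z \<notin> N} \<in> sets (lborel \<Otimes>\<^sub>M (lborel :: real measure))"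
    proof -
      have [measurable]: "N \<in> sets borel" using N(2) by auto
      show ?thesis by measurable
    qed
    show "AE x in lborel. AE y in lborel. fst (x, y) \<notin> N"
      using AE_not_in[OF N(2)] by (auto elim: eventually_mono)
  qed
  then have "AE z in (lborel :: ('a \<times> real) measure). P (fst z)"
    unfolding lborel_prod by eventually_elim (use N(1) in auto)
  then show ?thesis by (rule AE_completion)
qed

lemma L1_loc_of_locally_bounded_borel:
  fixes g :: "'b::euclidean_space \<Rightarrow> real"
  assumes [measurable]: "g \<in> borel_measurable borel"
    and bdd: "\<And>K. compact K \<Longrightarrow> K \<subseteq> S \<Longrightarrow> \<exists>C. \<forall>z\<in>K. \<bar>g z\<bar> \<le> C"
    and ae: "AE z in lebesgue. z \<in> S \<longrightarrow> g z = h z"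
  shows "L1_loc S h"
  unfolding L1_loc_def
proof (intro allI impI)
  fix K assume K: "compact K \<and> K \<subseteq> S"
  then obtain C where C: "\<forall>z\<in>K. \<bar>g z\<bar> \<le> C" using bdd[of K] by auto
  have [measurable]: "K \<in> sets borel" using K by (simp add: borel_compact)
  have "integrable lborel (\<lambda>z. indicator K z *\<^sub>R g z)"
    using K C by (intro integrable_compact_support[of _ K C]) auto
  then have i: "integrable lebesgue (\<lambda>z. indicator K z *\<^sub>R g z)"
    by (subst integrable_completion) auto
  have ae': "AE z in lebesgue. indicator K z *\<^sub>R g z = indicator K z *\<^sub>R h z"
    using ae
  proof eventually_elim
    case (elim z)
    with K show ?case by (cases "z \<in> K") auto
  qed
  have "(\<lambda>z. indicator K z *\<^sub>R h z) \<in> borel_measurable lebesgue"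
    by (rule borel_measurable_AE[OF borel_measurable_integrable[OF i] ae'])
  then show "h absolutely_integrable_on K"
    unfolding set_integrable_def by (rule integrable_cong_AE_imp[OF i _ ae'])
qed

text \<open>
  The datum \<open>u0\<close> is only Lebesgue measurable, and its values at all points enter the formula for the
  solution. Arguments that need Borel measurability, in particular Fubini's theorem, are made for a
  Borel function \<open>B\<close> that agrees with \<open>u0\<close> almost everywhere. Both are dominated by \<open>f\<close>, whose
  iterates satisfy the Picard bound with \<open>M\<close>.
\<close>

context
  fixes J u0 B f :: "'a::euclidean_space \<Rightarrow> real" and M :: "'a \<Rightarrow> real \<Rightarrow> real"
  assumes kernel: "convolution_kernel J"
    and B_borel [measurable]: "B \<in> borel_measurable borel"
    and f_borel [measurable]: "f \<in> borel_measurable borel"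
    and B_le: "\<And>x. \<bar>B x\<bar> \<le> f x"
    and u0_le: "\<And>x. \<bar>u0 x\<bar> \<le> f x"
    and u0_B: "AE x in lebesgue. u0 x = B x"
    and iterates_finite: "\<And>n x. (kconv J ^^ n) (\<lambda>y. ennreal (f y)) x < \<infinity>"
    and picard: "\<And>n x t. t \<ge> 0 \<Longrightarrow>
      (\<Sum>k\<le>n. enn2real ((kconv J ^^ k) (\<lambda>y. ennreal (f y)) x) / fact k * t ^ k) \<le> exp t * M x t"
    and M_cont: "continuous_on (UNIV \<times> {0..}) (\<lambda>(x, t). M x t)"
begin

abbreviation "majorant \<equiv> \<lambda>n x. enn2real ((kconv J ^^ n) (\<lambda>y. ennreal (f y)) x)"
abbreviation "iterate \<equiv> signed_iterate J B"

text \<open>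
  The functions \<open>sol\<close> and \<open>borel_sol\<close> differ only in the term with \<open>n = 0\<close>, so they agree almost
  everywhere; \<open>borel_sol_conv\<close> turns out to be the convolution of \<open>J\<close> with either of them.
\<close>

definition "datum_iterate n x = (if n = 0 then u0 x else iterate n x)"
definition "sol x t = poisson_mean (\<lambda>n. datum_iterate n x) t"
definition "borel_sol x t = poisson_mean (\<lambda>n. iterate n x) t"
definition "borel_sol_conv x t = poisson_mean (\<lambda>n. iterate (Suc n) x) t"

lemma iterate_le: "\<bar>iterate n x\<bar> \<le> majorant n x"
  by (rule signed_iterate_abs_le[OF kernel B_borel B_le iterates_finite])

lemma datum_iterate_le: "\<bar>datum_iterate n x\<bar> \<le> majorant n x"
proof (cases n)
  case 0
  have "f x \<ge> 0" using u0_le[of x] by linarith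
  with 0 u0_le show ?thesis by (simp add: datum_iterate_def)
next
  case (Suc m)
  then show ?thesis using iterate_le[of n x] by (simp add: datum_iterate_def)
qed

lemmas datum_iterate_bounds = poisson_mean_bounds[of "\<lambda>n. datum_iterate n x" "\<lambda>n. majorant n x" "M x" for x, OF datum_iterate_le picard]
lemmas iterate_bounds = poisson_mean_bounds[of "\<lambda>n. iterate n x" "\<lambda>n. majorant n x" "M x" for x, OF iterate_le picard]

lemma sol_le: "t \<ge> 0 \<Longrightarrow> \<bar>sol x t\<bar> \<le> M x t"
  unfolding sol_def by (rule datum_iterate_bounds(3))

lemma borel_sol_le: "t \<ge> 0 \<Longrightarrow> \<bar>borel_sol x t\<bar> \<le> M x t"
  unfolding borel_sol_def by (rule iterate_bounds(3))

lemma borel_sol_conv_le: "t \<ge> 0 \<Longrightarrow> \<bar>borel_sol_conv x t\<bar> \<le> exp 1 * M x (t + 1)"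
  unfolding borel_sol_conv_def by (rule iterate_bounds(4))

lemma sol_eq_borel_sol: "u0 x = B x \<Longrightarrow> sol x t = borel_sol x t"
proof -
  assume "u0 x = B x"
  then have "datum_iterate n x = iterate n x" for n
    using signed_iterate_0[OF kernel B_borel B_le iterates_finite] by (auto simp: datum_iterate_def)
  then show ?thesis by (simp add: sol_def borel_sol_def)
qed

lemma AE_sol_eq_borel_sol: "AE x in lebesgue. \<forall>t. sol x t = borel_sol x t"
  using u0_B by eventually_elim (simp add: sol_eq_borel_sol)

lemma AE_prod_sol_eq_borel_sol: "AE z in lebesgue. sol (fst z) (snd z) = borel_sol (fst z) (snd z)"
  using AE_lebesgue_fst[OF AE_sol_eq_borel_sol] by eventually_elim simp

lemma sol_continuous_in_time: "isCont (sol x) t"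
  unfolding sol_def[abs_def] by (rule DERIV_isCont[OF poisson_mean_derivative[OF datum_iterate_bounds(2)]])

lemma borel_sol_derivative: "(borel_sol x has_real_derivative borel_sol_conv x t - borel_sol x t) (at t)"
  unfolding borel_sol_def[abs_def] borel_sol_conv_def[abs_def] by (rule poisson_mean_derivative[OF iterate_bounds(2)])

lemma borel_sol_conv_continuous_in_time: "isCont (borel_sol_conv x) t"
  unfolding borel_sol_conv_def[abs_def]
  by (rule DERIV_isCont[OF poisson_mean_derivative[OF summable_shift_over_fact[OF iterate_bounds(2)]]])

lemma iterate_borel [measurable]: "iterate n \<in> borel_measurable borel"
  by (rule signed_iterate_measurable[OF kernel B_borel B_le iterates_finite])

lemma borel_sol_measurable [measurable]:
  "(\<lambda>z. borel_sol (fst z) (snd z)) \<in> borel_measurable borel"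
  "(\<lambda>z. borel_sol_conv (fst z) (snd z)) \<in> borel_measurable borel"
  "(\<lambda>x. borel_sol x t) \<in> borel_measurable borel"
proof -
  have "(\<lambda>z. borel_sol (fst z) (snd z)) \<in> borel_measurable (borel \<Otimes>\<^sub>M borel)"
    "(\<lambda>z. borel_sol_conv (fst z) (snd z)) \<in> borel_measurable (borel \<Otimes>\<^sub>M borel)"
    unfolding borel_sol_def borel_sol_conv_def poisson_mean_def by measurable
  then show "(\<lambda>z. borel_sol (fst z) (snd z)) \<in> borel_measurable borel"
    "(\<lambda>z. borel_sol_conv (fst z) (snd z)) \<in> borel_measurable borel" by (simp_all add: borel_prod)
  show "(\<lambda>x. borel_sol x t) \<in> borel_measurable borel"
    unfolding borel_sol_def poisson_mean_def by measurable
qed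

lemma bound_bounded_on_compact:
  assumes "compact K" and "K \<subseteq> UNIV \<times> {0..}"
  obtains C where "\<And>x t. (x, t) \<in> K \<Longrightarrow> M x t \<le> C"
proof -
  have "bounded ((\<lambda>(x, t). M x t) ` K)"
    by (intro compact_imp_bounded compact_continuous_image continuous_on_subset[OF M_cont] assms)
  then obtain C where "\<forall>z\<in>K. norm (case z of (x, t) \<Rightarrow> M x t) \<le> C"
    unfolding bounded_iff by auto
  then show ?thesis by (intro that[of C]) force
qed

lemma borel_sol_bounded_on_compact:
  assumes "compact K" and "K \<subseteq> UNIV \<times> {0..}"
  obtains C where "\<And>x t. (x, t) \<in> K \<Longrightarrow> \<bar>borel_sol x t\<bar> \<le> C" "\<And>x t. (x, t) \<in> K \<Longrightarrow> \<bar>borel_sol_conv x t\<bar> \<le> C"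
proof -
  obtain C1 where C1: "\<And>x t. (x, t) \<in> K \<Longrightarrow> M x t \<le> C1" by (rule bound_bounded_on_compact[OF assms]) blast
  let ?K = "(\<lambda>z. z + (0, 1)) ` K"
  have "compact ?K" by (intro compact_continuous_image continuous_intros assms)
  moreover have "?K \<subseteq> UNIV \<times> {0..}" using assms(2) by force
  ultimately obtain C2 where C2: "\<And>x t. (x, t) \<in> ?K \<Longrightarrow> M x t \<le> C2" by (rule bound_bounded_on_compact) blast
  have "\<bar>borel_sol x t\<bar> \<le> max C1 (exp 1 * C2)" "\<bar>borel_sol_conv x t\<bar> \<le> max C1 (exp 1 * C2)" if "(x, t) \<in> K" for x t
  proof -
    have t: "t \<ge> 0" using that assms(2) by auto
    show "\<bar>borel_sol x t\<bar> \<le> max C1 (exp 1 * C2)" using borel_sol_le[OF t, of x] C1[OF that] by linarith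
    have "(x, t + 1) \<in> ?K" using that by (force intro: image_eqI[of _ _ "(x, t)"])
    then have "exp 1 * M x (t + 1) \<le> exp 1 * C2" using C2 by (intro mult_left_mono) auto
    then show "\<bar>borel_sol_conv x t\<bar> \<le> max C1 (exp 1 * C2)" using borel_sol_conv_le[OF t, of x] by linarith
  qed
  then show ?thesis by (rule that)
qed

text \<open>
  The convolution may be taken term by term, since \<open>J\<close> convolved with the absolute values of the
  terms is dominated by the shifted series of the majorant.
\<close>

lemma conv_sol:
  assumes t: "t \<ge> 0"
  shows "conv_exists J (\<lambda>y. sol y t) x" and "conv J (\<lambda>y. sol y t) x = borel_sol_conv x t"
proof -
  note [measurable] = kernel_borel_measurable[OF kernel]
  have nonneg: "J y \<ge> 0" for y using kernel unfolding convolution_kernel_def by auto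
  let ?g = "\<lambda>n y. J (x - y) * iterate n y * (t ^ n / fact n)"
  have int: "integrable lborel (?g n)" for n
    using conv_signed_iterate(1)[OF kernel B_borel B_le iterates_finite, of x n] by simp
  have bound: "(\<integral>y. \<bar>?g n y\<bar> \<partial>lborel) \<le> majorant (Suc n) x / fact n * t ^ n" for n
  proof -
    have "(\<integral>y. \<bar>?g n y\<bar> \<partial>lborel) = (\<integral>y. J (x - y) * \<bar>iterate n y\<bar> * (t ^ n / fact n) \<partial>lborel)"
      using nonneg t by (simp add: abs_mult)
    also have "\<dots> = (\<integral>y. J (x - y) * \<bar>iterate n y\<bar> \<partial>lborel) * (t ^ n / fact n)"
      by simp
    also have "\<dots> \<le> majorant (Suc n) x * (t ^ n / fact n)"
      using t by (intro mult_right_mono conv_abs_signed_iterate_le[OF kernel B_borel B_le iterates_finite]) auto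
    finally show ?thesis by simp
  qed
  have "summable (\<lambda>n. majorant (Suc n) x / fact n * t ^ n)"
    by (rule summable_shift_over_fact[OF iterate_bounds(1)])
  then have "summable (\<lambda>n. \<integral>y. \<bar>?g n y\<bar> \<partial>lborel)"
    by (rule summable_comparison_test'[of _ 0]) (use bound in simp)
  note swap = integral_suminf_absolute[of lborel ?g, OF int this]
  have sum_g: "exp (- t) * (\<Sum>n. ?g n y) = J (x - y) * borel_sol y t" for y
    using suminf_mult[OF iterate_bounds(2)[of y t], of "J (x - y)"]
    by (simp add: borel_sol_def poisson_mean_def algebra_simps)
  have iU: "integrable lborel (\<lambda>y. J (x - y) * borel_sol y t)"
    using integrable_mult_right[OF swap(2), of "exp (- t)"] unfolding sum_g by simp
  have eqU: "(\<integral>y. J (x - y) * borel_sol y t \<partial>lborel) = borel_sol_conv x t"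
  proof -
    have "(\<integral>y. J (x - y) * borel_sol y t \<partial>lborel) = exp (- t) * (\<integral>y. (\<Sum>n. ?g n y) \<partial>lborel)"
      unfolding sum_g[symmetric] by simp
    also have "(\<integral>y. (\<Sum>n. ?g n y) \<partial>lborel) = (\<Sum>n. iterate (Suc n) x / fact n * t ^ n)"
      unfolding swap(3) using conv_signed_iterate(2)[OF kernel B_borel B_le iterates_finite, of x] by simp
    finally show ?thesis by (simp add: borel_sol_conv_def poisson_mean_def)
  qed
  have ae: "AE y in lebesgue. J (x - y) * borel_sol y t = J (x - y) * sol y t"
    using AE_sol_eq_borel_sol by eventually_elim simp
  have iU': "integrable lebesgue (\<lambda>y. J (x - y) * borel_sol y t)" using iU by (subst integrable_completion) auto
  have m: "(\<lambda>y. J (x - y) * sol y t) \<in> borel_measurable lebesgue"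
    by (rule borel_measurable_AE[OF borel_measurable_integrable[OF iU'] ae])
  show "conv_exists J (\<lambda>y. sol y t) x"
    unfolding conv_exists_def by (rule integrable_cong_AE_imp[OF iU' m ae])
  have "conv J (\<lambda>y. sol y t) x = (LINT y|lebesgue. J (x - y) * borel_sol y t)"
    unfolding conv_def using ae by (intro integral_cong_AE m borel_measurable_integrable[OF iU']) (auto elim: eventually_mono)
  also have "\<dots> = borel_sol_conv x t" unfolding eqU[symmetric] by (rule integral_lebesgue_borel) measurable
  finally show "conv J (\<lambda>y. sol y t) x = borel_sol_conv x t" .
qed

text \<open>
  Summation and integration are interchanged twice: for the kernels alone, whose total mass is
  \<open>e\<^sup>t - 1\<close>, which makes the series defining \<open>omega\<close> converge almost everywhere, and for the kernels
  times \<open>B\<close>, which gives the series for the solution.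
\<close>

lemma omega_representation:
  assumes t: "t \<ge> 0"
  shows "conv_exists (\<lambda>y. omega J y t) u0 x"
    and "sol x t = exp (- t) * u0 x + conv (\<lambda>y. omega J y t) u0 x"
proof -
  note [measurable] = kernel_borel_measurable[OF kernel]
  have cp_borel [measurable]: "conv_power J (Suc n) \<in> borel_measurable borel" for n
    unfolding conv_power_eq[OF kernel] by measurable
  let ?k = "\<lambda>n y. t ^ Suc n / fact (Suc n) * conv_power J (Suc n) (x - y)"
  have k_nonneg: "?k n y \<ge> 0" for n y
    using t conv_power_integral(3)[OF kernel] by simp
  have exp_sum: "summable (\<lambda>n. t ^ Suc n / fact (Suc n))"
    using summable_exp[of t] by (subst summable_Suc_iff) (simp add: field_simps)
  have int_k: "integrable lborel (?k n)" for n
    by (rule integrable_mult_right[OF conv_power_integral(1)[OF kernel]])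
  have mass_k: "(\<integral>y. \<bar>?k n y\<bar> \<partial>lborel) = t ^ Suc n / fact (Suc n)" for n
    unfolding abs_of_nonneg[OF k_nonneg] integral_mult_right_zero conv_power_integral(2)[OF kernel] by (rule mult_1_right)
  have "summable (\<lambda>n. \<integral>y. \<bar>?k n y\<bar> \<partial>lborel)"
    unfolding mass_k by (rule exp_sum)
  from integral_suminf_absolute(1)[of lborel ?k, OF int_k this]
  have k_ae: "AE y in lborel. summable (\<lambda>n. ?k n y)"
    unfolding abs_of_nonneg[OF k_nonneg] .
  let ?g = "\<lambda>n y. t ^ Suc n / fact (Suc n) * (conv_power J (Suc n) (x - y) * B y)"
  have int: "integrable lborel (?g n)" for n
    using conv_power_signed_iterate(1)[OF kernel B_borel B_le iterates_finite, of n x] by simp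
  have bound: "(\<integral>y. \<bar>?g n y\<bar> \<partial>lborel) \<le> majorant (Suc n) x / fact (Suc n) * t ^ Suc n" for n
  proof -
    have "(\<integral>y. \<bar>?g n y\<bar> \<partial>lborel) = (\<integral>y. t ^ Suc n / fact (Suc n) * (conv_power J (Suc n) (x - y) * \<bar>B y\<bar>) \<partial>lborel)"
      using t conv_power_integral(3)[OF kernel] by (simp add: abs_mult)
    also have "\<dots> = t ^ Suc n / fact (Suc n) * (\<integral>y. conv_power J (Suc n) (x - y) * \<bar>B y\<bar> \<partial>lborel)"
      by simp
    also have "\<dots> \<le> t ^ Suc n / fact (Suc n) * majorant (Suc n) x"
      using t by (intro mult_left_mono conv_power_abs_le[OF kernel B_borel B_le iterates_finite f_borel]) auto
    finally show ?thesis by (simp add: mult.commute)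
  qed
  have "summable (\<lambda>n. majorant (Suc n) x / fact (Suc n) * t ^ Suc n)"
    using iterate_bounds(1)[of x t] by (subst summable_Suc_iff)
  then have "summable (\<lambda>n. \<integral>y. \<bar>?g n y\<bar> \<partial>lborel)"
    by (rule summable_comparison_test'[of _ 0]) (use bound in simp)
  note swap = integral_suminf_absolute[of lborel ?g, OF int this]
  let ?G = "\<lambda>y. exp (- t) * (\<Sum>n. ?g n y)"
  have iG: "integrable lebesgue ?G"
    using integrable_mult_right[OF swap(2), of "exp (- t)"] by (subst integrable_completion) auto
  have ae: "AE y in lebesgue. ?G y = omega J (x - y) t * u0 y"
    using AE_completion[OF k_ae] u0_B
  proof eventually_elim
    case (elim y)
    then show ?case
      using suminf_mult2[OF elim(1), of "B y"] by (simp add: omega_def mult.assoc)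
  qed
  have m: "(\<lambda>y. omega J (x - y) t * u0 y) \<in> borel_measurable lebesgue"
    by (rule borel_measurable_AE[OF borel_measurable_integrable[OF iG] ae])
  show "conv_exists (\<lambda>y. omega J y t) u0 x"
    unfolding conv_exists_def by (rule integrable_cong_AE_imp[OF iG m ae])
  have "conv (\<lambda>y. omega J y t) u0 x = (LINT y|lebesgue. ?G y)"
    unfolding conv_def using ae by (intro integral_cong_AE m borel_measurable_integrable[OF iG]) (auto elim: eventually_mono)
  also have "\<dots> = (\<integral>y. ?G y \<partial>lborel)" by (rule integral_lebesgue_borel) measurable
  also have "\<dots> = exp (- t) * (\<integral>y. (\<Sum>n. ?g n y) \<partial>lborel)" by simp
  also have "(\<integral>y. (\<Sum>n. ?g n y) \<partial>lborel) = (\<Sum>n. datum_iterate (Suc n) x / fact (Suc n) * t ^ Suc n)"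
    unfolding swap(3) using conv_power_signed_iterate(2)[OF kernel B_borel B_le iterates_finite, of _ x]
    by (simp add: datum_iterate_def mult.commute)
  finally have conv_eq: "conv (\<lambda>y. omega J y t) u0 x = exp (- t) * (\<Sum>n. datum_iterate (Suc n) x / fact (Suc n) * t ^ Suc n)" .
  have "datum_iterate 0 x / fact 0 * t ^ 0 = u0 x" by (simp add: datum_iterate_def)
  with suminf_split_head[OF datum_iterate_bounds(2)[of x t]]
  have "(\<Sum>n. datum_iterate n x / fact n * t ^ n) = u0 x + (\<Sum>n. datum_iterate (Suc n) x / fact (Suc n) * t ^ Suc n)"
    by linarith
  then show "sol x t = exp (- t) * u0 x + conv (\<lambda>y. omega J y t) u0 x"
    unfolding conv_eq sol_def poisson_mean_def by (simp only: distrib_left)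
qed

text \<open>
  The solution is continuous in \<open>t\<close> at every \<open>x\<close> and bounded on compact sets by \<open>M\<close>, so dominated
  convergence applies.
\<close>

lemma C0_L1_loc_sol: "C0_L1_loc sol"
  unfolding C0_L1_loc_def
proof (intro conjI allI impI)
  fix t :: real assume t: "t \<ge> 0"
  show "L1_loc UNIV (\<lambda>x. sol x t)"
  proof (rule L1_loc_of_locally_bounded_borel)
    fix K :: "'a set" assume "compact K"
    then have "compact (K \<times> {t})" "K \<times> {t} \<subseteq> UNIV \<times> {0..}" using t by (auto intro: compact_Times)
    then obtain C where "\<And>x s. (x, s) \<in> K \<times> {t} \<Longrightarrow> \<bar>borel_sol x s\<bar> \<le> C" by (rule borel_sol_bounded_on_compact) blast
    then show "\<exists>C. \<forall>x\<in>K. \<bar>borel_sol x t\<bar> \<le> C" by auto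
  qed (use AE_sol_eq_borel_sol in \<open>auto elim: eventually_mono\<close>)
next
  fix K :: "'a set" and t :: real
  assume K: "compact K" and t: "t \<ge> 0"
  show "((\<lambda>s. LINT x:K|lebesgue. \<bar>sol x s - sol x t\<bar>) \<longlongrightarrow> 0) (at t within {0..})"
    unfolding tendsto_at_iff_sequentially comp_def
  proof (intro allI impI)
    fix X :: "nat \<Rightarrow> real"
    assume X: "\<forall>i. X i \<in> {0..} - {t}" and lim: "X \<longlonglongrightarrow> t"
    obtain R where R: "\<And>i. X i \<le> R"
      using convergent_imp_Bseq[OF convergentI[OF lim]] unfolding Bseq_def by (metis abs_le_D1 real_norm_def)
    have "compact (K \<times> {0..max R t})" "K \<times> {0..max R t} \<subseteq> UNIV \<times> {0..}"
      using K by (auto intro: compact_Times)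
    then obtain C where C: "\<And>x s. (x, s) \<in> K \<times> {0..max R t} \<Longrightarrow> M x s \<le> C" by (rule bound_bounded_on_compact) blast
    have K_sets: "K \<in> sets lebesgue" using K by (simp add: borel_compact)
    have u_meas: "(\<lambda>x. sol x s) \<in> borel_measurable lebesgue" for s
      by (rule borel_measurable_AE[of "\<lambda>x. borel_sol x s"])
        (use AE_sol_eq_borel_sol in \<open>auto elim: eventually_mono intro: measurable_completion\<close>)
    have "(\<lambda>i. LINT x|lebesgue. indicator K x *\<^sub>R \<bar>sol x (X i) - sol x t\<bar>) \<longlonglongrightarrow> (LINT x|(lebesgue :: 'a measure). (0::real))"
    proof (rule Bochner_Integration.integral_dominated_convergence[where w = "\<lambda>x. indicator K x * (2 * C)"])
      have [measurable]: "K \<in> sets borel" using K by (rule borel_compact)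
      have "integrable lborel (\<lambda>x. indicator K x * (2 * C) :: real)"
        using K by (intro integrable_compact_support[of _ K "\<bar>2 * C\<bar>"]) auto
      then show "integrable lebesgue (\<lambda>x. indicator K x * (2 * C) :: real)"
        by (subst integrable_completion) auto
      show "AE x in lebesgue. (\<lambda>i. indicator K x *\<^sub>R \<bar>sol x (X i) - sol x t\<bar>) \<longlonglongrightarrow> 0"
      proof (rule AE_I2)
        fix x
        have "(\<lambda>i. sol x (X i)) \<longlonglongrightarrow> sol x t" by (rule isCont_tendsto_compose[OF sol_continuous_in_time lim])
        then have "(\<lambda>i. \<bar>sol x (X i) - sol x t\<bar>) \<longlonglongrightarrow> 0"
          by (intro tendsto_rabs_zero) (simp add: LIM_zero_iff)
        then show "(\<lambda>i. indicator K x *\<^sub>R \<bar>sol x (X i) - sol x t\<bar>) \<longlonglongrightarrow> 0"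
          using tendsto_mult_left[of "\<lambda>i. \<bar>sol x (X i) - sol x t\<bar>" 0 sequentially "indicator K x"] by simp
      qed
      show "AE x in lebesgue. norm (indicator K x *\<^sub>R \<bar>sol x (X i) - sol x t\<bar>) \<le> indicator K x * (2 * C)" for i
      proof (rule AE_I2)
        fix x
        have "\<bar>sol x (X i) - sol x t\<bar> \<le> 2 * C" if "x \<in> K"
          using sol_le[of "X i" x] sol_le[OF t, of x] C[of x "X i"] C[of x t] that X R[of i] t by fastforce
        then show "norm (indicator K x *\<^sub>R \<bar>sol x (X i) - sol x t\<bar>) \<le> indicator K x * (2 * C)"
          by (auto simp: indicator_def)
      qed
    qed (use K_sets u_meas in \<open>auto intro!: borel_measurable_scaleR borel_measurable_abs borel_measurable_diff\<close>)
    then show "(\<lambda>i. LINT x:K|lebesgue. \<bar>sol x (X i) - sol x t\<bar>) \<longlonglongrightarrow> 0"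
      by (simp add: set_lebesgue_integral_def)
  qed
qed

lemma L1_loc_Q_plus_sol:
  "L1_loc Q_plus (\<lambda>(x, t). sol x t)"
  "L1_loc Q_plus (\<lambda>z. borel_sol_conv (fst z) (snd z) - borel_sol (fst z) (snd z))"
  "L1_loc Q_plus (\<lambda>(x, t). conv J (\<lambda>y. sol y t) x)"
proof -
  have bdd: "\<exists>C. \<forall>z\<in>K. \<bar>borel_sol (fst z) (snd z)\<bar> \<le> C \<and> \<bar>borel_sol_conv (fst z) (snd z)\<bar> \<le> C"
    if "compact K" "K \<subseteq> Q_plus" for K :: "('a \<times> real) set"
  proof -
    have "K \<subseteq> UNIV \<times> {0..}" using that(2) by auto
    with that(1) obtain C where "\<And>x t. (x, t) \<in> K \<Longrightarrow> \<bar>borel_sol x t\<bar> \<le> C" "\<And>x t. (x, t) \<in> K \<Longrightarrow> \<bar>borel_sol_conv x t\<bar> \<le> C"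
      by (rule borel_sol_bounded_on_compact) blast
    then show ?thesis by (intro exI[of _ C]) auto
  qed
  show "L1_loc Q_plus (\<lambda>(x, t). sol x t)"
    by (rule L1_loc_of_locally_bounded_borel[OF borel_sol_measurable(1)])
      (use bdd AE_prod_sol_eq_borel_sol in \<open>fastforce elim: eventually_mono\<close>)+
  show "L1_loc Q_plus (\<lambda>z. borel_sol_conv (fst z) (snd z) - borel_sol (fst z) (snd z))"
  proof (rule L1_loc_of_locally_bounded_borel)
    fix K :: "('a \<times> real) set" assume "compact K" "K \<subseteq> Q_plus"
    from bdd[OF this] obtain C where C: "\<And>z. z \<in> K \<Longrightarrow> \<bar>borel_sol (fst z) (snd z)\<bar> \<le> C \<and> \<bar>borel_sol_conv (fst z) (snd z)\<bar> \<le> C"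
      by blast
    have "\<bar>borel_sol_conv (fst z) (snd z) - borel_sol (fst z) (snd z)\<bar> \<le> C + C" if "z \<in> K" for z
      using C[OF that] by linarith
    then show "\<exists>C. \<forall>z\<in>K. \<bar>borel_sol_conv (fst z) (snd z) - borel_sol (fst z) (snd z)\<bar> \<le> C" by blast
  qed auto
  show "L1_loc Q_plus (\<lambda>(x, t). conv J (\<lambda>y. sol y t) x)"
  proof (rule L1_loc_of_locally_bounded_borel[OF borel_sol_measurable(2)])
    show "\<exists>C. \<forall>z\<in>K. \<bar>borel_sol_conv (fst z) (snd z)\<bar> \<le> C" if "compact K" "K \<subseteq> Q_plus" for K
      using bdd[OF that] by blast
    show "AE z in lebesgue. z \<in> Q_plus \<longrightarrow> borel_sol_conv (fst z) (snd z) = (case z of (x, t) \<Rightarrow> conv J (\<lambda>y. sol y t) x)"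
      by (intro AE_I2) (auto simp: conv_sol)
  qed
qed

lemma weak_time_derivative_sol:
  "has_weak_time_deriv sol (\<lambda>z. borel_sol_conv (fst z) (snd z) - borel_sol (fst z) (snd z))"
  unfolding has_weak_time_deriv_def
proof (intro conjI allI impI L1_loc_Q_plus_sol)
  fix \<phi> :: "'a \<times> real \<Rightarrow> real" assume \<phi>: "test_function \<phi>"
  have "(LINT (x, t):Q_plus|lebesgue. borel_sol x t * time_deriv \<phi> (x, t)) =
      - (LINT (x, t):Q_plus|lebesgue. (borel_sol_conv x t - borel_sol x t) * \<phi> (x, t))"
  proof (rule integration_by_parts_test_function[OF \<phi>])
    show "isCont (\<lambda>t. borel_sol_conv x t - borel_sol x t) t" for x t
      by (intro continuous_intros borel_sol_conv_continuous_in_time DERIV_isCont[OF borel_sol_derivative])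
    fix R l r :: real assume "l > 0"
    have "compact (cball 0 R \<times> {l..r} :: ('a \<times> real) set)" by (intro compact_Times) auto
    moreover have "cball 0 R \<times> {l..r} \<subseteq> (UNIV \<times> {0..} :: ('a \<times> real) set)" using \<open>l > 0\<close> by auto
    ultimately obtain C where C: "\<And>x t. (x, t) \<in> cball 0 R \<times> {l..r} \<Longrightarrow> \<bar>borel_sol x t\<bar> \<le> C"
        "\<And>x t. (x, t) \<in> cball 0 R \<times> {l..r} \<Longrightarrow> \<bar>borel_sol_conv x t\<bar> \<le> C"
      by (rule borel_sol_bounded_on_compact) blast
    have "\<bar>borel_sol x t\<bar> \<le> C + C \<and> \<bar>borel_sol_conv x t - borel_sol x t\<bar> \<le> C + C" if "x \<in> cball 0 R" "t \<in> {l..r}" for x t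
      using C(1)[of x t] C(2)[of x t] that by (simp del: mem_cball) linarith
    then show "\<exists>C. \<forall>x\<in>cball 0 R. \<forall>t\<in>{l..r}. \<bar>borel_sol x t\<bar> \<le> C \<and> \<bar>borel_sol_conv x t - borel_sol x t\<bar> \<le> C" by blast
  qed (use borel_sol_derivative in auto)
  moreover have "(LINT (x, t):Q_plus|lebesgue. sol x t * time_deriv \<phi> (x, t)) =
      (LINT (x, t):Q_plus|lebesgue. borel_sol x t * time_deriv \<phi> (x, t))"
  proof -
    have d_borel: "time_deriv \<phi> \<in> borel_measurable borel"
      by (rule borel_measurable_continuous_onI[OF test_function_time_derivative(2)[OF \<phi>]])
    have "open (Q_plus :: ('a \<times> real) set)" by (intro open_Times) auto
    then have Q [measurable]: "Q_plus \<in> sets (borel :: ('a \<times> real) measure)" by simp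
    have m: "(\<lambda>z. indicator Q_plus z *\<^sub>R (case z of (x, t) \<Rightarrow> borel_sol x t * time_deriv \<phi> (x, t))) \<in> borel_measurable lebesgue"
      unfolding case_prod_unfold using d_borel by (intro measurable_completion) auto
    have ae: "AE z in lebesgue. indicator Q_plus z *\<^sub>R (case z of (x, t) \<Rightarrow> borel_sol x t * time_deriv \<phi> (x, t)) =
        indicator Q_plus z *\<^sub>R (case z of (x, t) \<Rightarrow> sol x t * time_deriv \<phi> (x, t))"
      using AE_prod_sol_eq_borel_sol by eventually_elim (simp add: case_prod_unfold)
    show ?thesis
      unfolding set_lebesgue_integral_def
      by (intro integral_cong_AE borel_measurable_AE[OF m ae] m) (use ae in \<open>auto elim: eventually_mono\<close>)
  qed
  ultimately show "(LINT (x, t):Q_plus|lebesgue. sol x t * time_deriv \<phi> (x, t)) =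
      - (LINT z:Q_plus|lebesgue. (borel_sol_conv (fst z) (snd z) - borel_sol (fst z) (snd z)) * \<phi> z)"
    by (simp add: case_prod_unfold)
qed

lemma strong_solution_sol: "strong_solution J u0 sol"
  unfolding strong_solution_def
proof (intro conjI exI[of _ "\<lambda>z. borel_sol_conv (fst z) (snd z) - borel_sol (fst z) (snd z)"])
  show "C0_L1_loc sol" by (rule C0_L1_loc_sol)
  show "space_conv_L1_loc J sol"
    unfolding space_conv_L1_loc_def using L1_loc_Q_plus_sol(3) conv_sol(1) by (auto intro!: AE_I2)
  show "has_weak_time_deriv sol (\<lambda>z. borel_sol_conv (fst z) (snd z) - borel_sol (fst z) (snd z))"
    by (rule weak_time_derivative_sol)
  show "AE (x, t) in lebesgue. t > 0 \<longrightarrow>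
      borel_sol_conv (fst (x, t)) (snd (x, t)) - borel_sol (fst (x, t)) (snd (x, t)) = conv J (\<lambda>y. sol y t) x - sol x t"
    using AE_prod_sol_eq_borel_sol by eventually_elim (auto simp: conv_sol)
  show "AE x in lebesgue. sol x 0 = u0 x"
  proof (rule AE_I2)
    fix x
    have "(\<Sum>n. datum_iterate n x / fact n * 0 ^ n) = datum_iterate 0 x"
      using powser_zero[of "\<lambda>n. datum_iterate n x / fact n"] by simp
    then show "sol x 0 = u0 x" by (simp add: sol_def poisson_mean_def datum_iterate_def)
  qed
qed

end

theorem theorem3p3:
  fixes J u0 :: "'a::euclidean_space \<Rightarrow> real"
    and \<psi> :: "'a \<Rightarrow> real \<Rightarrow> real"
    and c0 :: real
  assumes "convolution_kernel J"
    and "continuous_on (UNIV \<times> {0..}) (\<lambda>(x, t). \<psi> x t)"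
    and "\<And>x t. t \<ge> 0 \<Longrightarrow> \<psi> x t \<ge> 0"
    and "\<And>M. \<forall>\<^sub>F x in at_infinity. \<forall>t\<ge>0. \<psi> x t \<ge> M"
    and "time_deriv_ge J \<psi>"
    and "u0 \<in> borel_measurable lebesgue"
    and "locally_bounded u0"
    and "c0 > 0"
    and "\<And>x. \<bar>u0 x\<bar> \<le> c0 * \<psi> x 0"
  shows "\<exists>u. strong_solution J u0 u \<and>
    (\<forall>x. \<forall>t\<ge>0. conv_exists (\<lambda>y. omega J y t) u0 x \<and>
       u x t = exp (- t) * u0 x + conv (\<lambda>y. omega J y t) u0 x) \<and>
    (\<forall>x. \<forall>t>0. \<bar>u x t\<bar> \<le> c0 * \<psi> x t)"
proof -
  have J: "\<And>y. J y \<ge> 0" "continuous_on UNIV J"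
    using assms(1) unfolding convolution_kernel_def by auto
  note [measurable] = kernel_borel_measurable[OF assms(1)]
  define f where "f = (\<lambda>x. c0 * \<psi> x 0)"
  define M where "M = (\<lambda>x t. c0 * \<psi> x t)"
  have "continuous_on UNIV (\<lambda>x. case (x, 0) of (x, t) \<Rightarrow> \<psi> x t)"
    by (rule continuous_on_compose2[OF assms(2)]) (auto intro!: continuous_intros)
  then have \<psi>0 [measurable]: "(\<lambda>x. \<psi> x 0) \<in> borel_measurable borel"
    by (intro borel_measurable_continuous_onI) simp
  then have f_borel: "f \<in> borel_measurable borel" by (simp add: f_def)
  have f_nonneg: "f x \<ge> 0" for x using assms(3,8) by (simp add: f_def)
  obtain B0 where B0: "B0 \<in> borel_measurable lborel" "AE x in lborel. u0 x = B0 x"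
    using completion_ex_borel_measurable_real[OF assms(6)] by blast
  \<comment> \<open>Clipping makes the domination by \<open>f\<close> hold at every point and not only almost everywhere.\<close>
  define B where "B = (\<lambda>x. max (- f x) (min (f x) (B0 x)))"
  have B_borel: "B \<in> borel_measurable borel" using B0(1) f_borel by (simp add: B_def)
  have B_le: "\<bar>B x\<bar> \<le> f x" for x using f_nonneg[of x] by (auto simp: B_def)
  have u0_le: "\<bar>u0 x\<bar> \<le> f x" for x using assms(9) by (simp add: f_def)
  have u0_B: "AE x in lebesgue. u0 x = B x"
    using AE_completion[OF B0(2)]
  proof eventually_elim
    case (elim x)
    then show ?case using u0_le[of x] by (simp add: B_def)
  qed
  have scale: "(kconv J ^^ n) (\<lambda>y. ennreal (f y)) x = ennreal c0 * (kconv J ^^ n) (\<lambda>y. ennreal (\<psi> y 0)) x" for n x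
  proof (induction n arbitrary: x)
    case 0
    then show ?case using assms(3,8) by (simp add: f_def ennreal_mult')
  next
    case (Suc n)
    have "kconv J (\<lambda>y. ennreal c0 * g y) x = ennreal c0 * kconv J g x"
      if [measurable]: "g \<in> borel_measurable borel" for g
      unfolding kconv_def by (subst nn_integral_cmult[symmetric]) (auto simp: ac_simps)
    moreover have "(kconv J ^^ n) (\<lambda>y. ennreal (f y)) = (\<lambda>x. ennreal c0 * (kconv J ^^ n) (\<lambda>y. ennreal (\<psi> y 0)) x)"
      using Suc by auto
    ultimately show ?case by simp
  qed
  have picard: "(\<Sum>k\<le>n. ennreal (t ^ k / fact k) * (kconv J ^^ k) (\<lambda>y. ennreal (f y)) x) \<le> ennreal (exp t * M x t)"
    if "t \<ge> 0" for n x t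
  proof -
    have "(\<Sum>k\<le>n. ennreal (t ^ k / fact k) * (kconv J ^^ k) (\<lambda>y. ennreal (f y)) x) =
        ennreal c0 * (\<Sum>k\<le>n. ennreal (t ^ k / fact k) * (kconv J ^^ k) (\<lambda>y. ennreal (\<psi> y 0)) x)"
      by (simp add: scale sum_distrib_left mult.left_commute)
    also have "\<dots> \<le> ennreal c0 * ennreal (exp t * \<psi> x t)"
      using that assms(3) by (intro mult_left_mono picard_bound[OF J assms(2) _ assms(5)]) auto
    also have "\<dots> = ennreal (exp t * M x t)"
      using assms(3,8) that by (simp add: M_def ennreal_mult'[symmetric] algebra_simps)
    finally show ?thesis .
  qed
  have finite: "(kconv J ^^ n) (\<lambda>y. ennreal (f y)) x < \<infinity>" for n x
  proof -
    have "ennreal (1 ^ n / fact n) * (kconv J ^^ n) (\<lambda>y. ennreal (f y)) x \<le>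
        (\<Sum>k\<le>n. ennreal (1 ^ k / fact k) * (kconv J ^^ k) (\<lambda>y. ennreal (f y)) x)"
      by (rule member_le_sum) auto
    also have "\<dots> < \<infinity>" using picard[where t = 1 and n = n and x = x] by (simp add: le_less_trans)
    finally show ?thesis by (auto simp: ennreal_mult_less_top)
  qed
  have picard_real: "(\<Sum>k\<le>n. enn2real ((kconv J ^^ k) (\<lambda>y. ennreal (f y)) x) / fact k * t ^ k) \<le> exp t * M x t"
    if t: "t \<ge> 0" for n x t
  proof -
    have "ennreal (\<Sum>k\<le>n. enn2real ((kconv J ^^ k) (\<lambda>y. ennreal (f y)) x) / fact k * t ^ k) =
        (\<Sum>k\<le>n. ennreal (enn2real ((kconv J ^^ k) (\<lambda>y. ennreal (f y)) x) / fact k * t ^ k))"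
      using t by (intro sum_ennreal[symmetric]) simp
    also have "\<dots> = (\<Sum>k\<le>n. ennreal (t ^ k / fact k) * (kconv J ^^ k) (\<lambda>y. ennreal (f y)) x)"
    proof (rule sum.cong[OF refl])
      fix k
      let ?a = "(kconv J ^^ k) (\<lambda>y. ennreal (f y)) x"
      have "ennreal (t ^ k / fact k * enn2real ?a) = ennreal (t ^ k / fact k) * ennreal (enn2real ?a)"
        using t by (intro ennreal_mult') simp
      also have "ennreal (enn2real ?a) = ?a" using finite[of k x] by simp
      finally show "ennreal (enn2real ?a / fact k * t ^ k) = ennreal (t ^ k / fact k) * ?a"
        by (simp only: times_divide_eq_left times_divide_eq_right mult.commute)
    qed
    also have "\<dots> \<le> ennreal (exp t * M x t)" by (rule picard[OF t])
    finally show ?thesis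
      using t assms(3,8) by (subst (asm) ennreal_le_iff) (auto simp: M_def)
  qed
  have M_cont: "continuous_on (UNIV \<times> {0..}) (\<lambda>(x, t). M x t)"
    using assms(2) unfolding M_def case_prod_unfold by (intro continuous_intros)
  note solution = assms(1) B_borel f_borel B_le u0_le u0_B finite picard_real M_cont
  show ?thesis
    using strong_solution_sol[OF solution] omega_representation[OF solution] sol_le[OF solution]
    unfolding M_def by (intro exI[of _ "sol J u0 B"]) auto
qed

end
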